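(* Let $X$ be a Banach space, let $Y$ be a separable Banach space, and let $T\colon X\to Y$ be a bounded linear operator. Then $T$ is strictly cosingular if and only if its adjoint $T^*\colon Y^*\to X^*$ is strictly singular.
   Context: Banach spaces are over $\mathbb K=\mathbb R$ or $\mathbb C$. A bounded operator $S\colon E\to F$ between Banach spaces is strictly singular if $S$ is not bounded below on any infinite-dimensional (norm-closed) subspace of $E$, where bounded below on $Z$ means that there is $c>0$ with $\|Sz\|\ge c\|z\|$ for all $z\in Z$. A bounded operator $T\colon X\to Y$ is strictly cosingular if, for every closed subspace $M\subset Y$ of infinite codimension, the operator $Q_MT\colon X\to Y/M$ is not surjective, where $Q_M\colon Y\to Y/M$ is the quotient map. *)

theory Defs
  imports "HOL-Analysis.Analysis" "HOL-Library.Set_Algebras"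
begin

(* A Banach space over 'k, where 'k is real or complex. The type class banach supplies the norm,
   completeness and the underlying real structure; the K-structure is a compatible scalar
   multiplication. For 'k = real, smul is necessarily scaleR. *)
locale banach_space_over = vector_space smul
  for smul :: "'k::real_normed_field \<Rightarrow> 'a::banach \<Rightarrow> 'a" +
  assumes smul_of_real: "smul (of_real r) x = r *\<^sub>R x"
    and norm_smul: "norm (smul c x) = norm c * norm x"

definition finite_dim :: "('k::field \<Rightarrow> 'a::ab_group_add \<Rightarrow> 'a) \<Rightarrow> 'a set \<Rightarrow> bool" where
  "finite_dim smul Z \<longleftrightarrow> (\<exists>B. finite B \<and> module.span smul B = Z)"

definition bounded_below_on :: "('a::real_normed_vector \<Rightarrow> 'b::real_normed_vector) \<Rightarrow> 'a set \<Rightarrow> bool"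
  where "bounded_below_on S Z \<longleftrightarrow> (\<exists>c>0. \<forall>z\<in>Z. norm (S z) \<ge> c * norm z)"

(* The domain is a closed subspace E of an ambient Banach space, so that the
   complex dual below is admissible; closedness in E and in the ambient space agree. *)
definition strictly_singular_on ::
    "('k::real_normed_field \<Rightarrow> 'a::banach \<Rightarrow> 'a) \<Rightarrow> 'a set \<Rightarrow> ('a \<Rightarrow> 'b::banach) \<Rightarrow> bool" where
  "strictly_singular_on smul E S \<longleftrightarrow>
     (\<forall>Z\<subseteq>E. module.subspace smul Z \<and> closed Z \<and> \<not> finite_dim smul Z \<longrightarrow> \<not> bounded_below_on S Z)"

(* Y/M is the set of cosets of M. *)
definition quotient_map_mod :: "'b::ab_group_add set \<Rightarrow> 'b \<Rightarrow> 'b set" where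
  "quotient_map_mod M y = y +o M"

definition quotient_mod :: "'b::ab_group_add set \<Rightarrow> 'b set set" where
  "quotient_mod M = range (quotient_map_mod M)"

(* Y/M is spanned by the cosets of finitely many vectors: the image of the span of B under the
   linear quotient map is the span of the image of B. *)
definition finite_codim :: "('k::field \<Rightarrow> 'b::ab_group_add \<Rightarrow> 'b) \<Rightarrow> 'b set \<Rightarrow> bool" where
  "finite_codim smul M \<longleftrightarrow>
     (\<exists>B. finite B \<and> quotient_map_mod M ` module.span smul B = quotient_mod M)"

definition strictly_cosingular ::
    "('k::real_normed_field \<Rightarrow> 'b::banach \<Rightarrow> 'b) \<Rightarrow> ('a::banach \<Rightarrow> 'b) \<Rightarrow> bool" where
  "strictly_cosingular smul T \<longleftrightarrow>
     (\<forall>M. module.subspace smul M \<and> closed M \<and> \<not> finite_codim smul M \<longrightarrow>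
        range (quotient_map_mod M \<circ> T) \<noteq> quotient_mod M)"

(* The K-linear functionals among the bounded real-linear maps into K, with the operator norm
   of the blinfun type; for 'k = real this is the whole type. *)
definition dual_space ::
    "('k::real_normed_field \<Rightarrow> 'a::banach \<Rightarrow> 'a) \<Rightarrow> ('a \<Rightarrow>\<^sub>L 'k) set" where
  "dual_space smul = {f. Vector_Spaces.linear smul (*) (blinfun_apply f)}"

(* (c f)(x) = c * f x *)
definition dual_scale :: "'k::real_normed_field \<Rightarrow> ('a::banach \<Rightarrow>\<^sub>L 'k) \<Rightarrow> ('a \<Rightarrow>\<^sub>L 'k)" where
  "dual_scale c f = blinfun_mult_right c o\<^sub>L f"

definition dual_map ::
    "('a::banach \<Rightarrow>\<^sub>L 'b::banach) \<Rightarrow> ('b \<Rightarrow>\<^sub>L 'k::real_normed_field) \<Rightarrow> ('a \<Rightarrow>\<^sub>L 'k)" where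
  "dual_map T f = f o\<^sub>L T"

lemma banach_space_over_scaleR:
  "banach_space_over (scaleR :: real \<Rightarrow> 'a::banach \<Rightarrow> 'a)"
  by unfold_locales (auto simp: algebra_simps)

lemma banach_space_over_dual_scale:
  "banach_space_over (dual_scale :: 'k::{real_normed_field, banach} \<Rightarrow> ('a::banach \<Rightarrow>\<^sub>L 'k) \<Rightarrow> _)"
proof unfold_locales
  fix c :: 'k and f :: "'a \<Rightarrow>\<^sub>L 'k"
  have le: "norm (dual_scale c f) \<le> norm c * norm f" for c :: 'k and f :: "'a \<Rightarrow>\<^sub>L 'k"
    by (rule norm_blinfun_bound)
      (auto simp: dual_scale_def norm_mult mult.assoc intro!: mult_left_mono norm_blinfun)
  show "norm (dual_scale c f) = norm c * norm f"
  proof (cases "c = 0")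
    case False
    have "f = dual_scale (inverse c) (dual_scale c f)"
      using False by (intro blinfun_eqI) (simp add: dual_scale_def)
    then have "norm f \<le> norm (inverse c) * norm (dual_scale c f)"
      using le by metis
    then have "norm c * norm f \<le> norm (dual_scale c f)"
      using False by (simp add: norm_divide field_simps)
    then show ?thesis using le[of c f] by simp
  qed (use le[of 0 f] in simp)
qed (auto intro!: blinfun_eqI
      simp: dual_scale_def blinfun.bilinear_simps algebra_simps scaleR_conv_of_real)

lemma dual_space_scaleR: "dual_space (scaleR :: real \<Rightarrow> 'a::banach \<Rightarrow> 'a) = UNIV"
proof -
  have "linear (blinfun_apply f)" for f :: "'a \<Rightarrow>\<^sub>L real"
    by (simp add: blinfun.bounded_linear_right bounded_linear.linear)
  then show ?thesis
    by (simp add: dual_space_def linear_def real_scaleR_def[abs_def])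
qed

lemma dual_map_in_dual_space:
  assumes "Vector_Spaces.linear sX sY (blinfun_apply T)" "f \<in> dual_space sY"
  shows "dual_map T f \<in> dual_space sX"
proof -
  have "blinfun_apply (dual_map T f) = blinfun_apply f \<circ> blinfun_apply T"
    by (auto simp: dual_map_def)
  then show ?thesis
    using Vector_Spaces.linear_compose[OF assms(1)] assms(2) by (simp add: dual_space_def)
qed

end

theory Submission
  imports Defs
begin

text \<open>If \<open>T\<close> induces a surjection onto \<open>Y/M\<close>, then by Baire the adjoint is bounded below on the annihilator
  of \<open>M\<close>, which is infinite-dimensional by Hahn-Banach.

  Conversely, let \<open>T\<^sup>*\<close> be bounded below on an infinite-dimensional subspace \<open>Z\<close> of \<open>Y\<^sup>*\<close>.
  By Hahn-Banach, finitely many values \<open>z (y)\<close>, \<open>z \<in> Z\<close>, are approximated by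
  \<open>z (T u)\<close> with \<open>u\<close> bounded in terms of \<open>\<parallel>y\<parallel>\<close>, and a finite set of such \<open>u\<close> serves the whole ball. As \<open>Z\<close> is
  infinite-dimensional, it contains unit functionals vanishing on any prescribed finite set. One
  therefore chooses \<open>z\<^sub>0, z\<^sub>1, \<dots>\<close> in \<open>Z\<close>, together with an almost biorthogonal bounded sequence in
  \<open>Y\<close>, so that \<open>z\<^sub>n\<close> kills the first \<open>n\<close> points of a dense sequence and the images of all
  approximants chosen so far. For \<open>M = \<Inter>n. ker z\<^sub>n\<close>, the functionals \<open>z\<^sub>k\<close> then distinguish
  a dense point from the image of its \<open>n\<close>-th approximant only slightly and only for \<open>k < n\<close>; a
  triangular system removes this error, so \<open>T\<close> is onto modulo \<open>M\<close>.\<close>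

section \<open>Hahn-Banach over the reals and the complex numbers\<close>

definition sublinear :: "('a::real_vector \<Rightarrow> real) \<Rightarrow> bool" where
  "sublinear p \<longleftrightarrow> (\<forall>x y. p (x + y) \<le> p x + p y) \<and> (\<forall>t\<ge>0. \<forall>x. p (t *\<^sub>R x) = t * p x)"

text \<open>Homogeneity needs only one inequality, because that inequality for
  \<open>inverse t\<close> at \<open>t *\<^sub>R x\<close> is the reverse one for \<open>t\<close>
  at \<open>x\<close>. This suits functionals defined as infima.\<close>

lemma sublinearI:
  assumes "\<And>x y. p (x + y) \<le> p x + p y" and le: "\<And>t x. t > 0 \<Longrightarrow> p (t *\<^sub>R x) \<le> t * p x"
    and "p 0 = 0"
  shows "sublinear p"
proof -
  have "p (t *\<^sub>R x) = t * p x" if "t > 0" for t x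
  proof (rule antisym)
    show "t * p x \<le> p (t *\<^sub>R x)"
      using le[of "inverse t" "t *\<^sub>R x"] that by (simp add: field_simps)
  qed (rule le[OF that])
  then show ?thesis
    using assms by (force simp: sublinear_def le_less)
qed

lemma sublinear_add: "sublinear p \<Longrightarrow> p (x + y) \<le> p x + p y"
  and sublinear_scale: "sublinear p \<Longrightarrow> t \<ge> 0 \<Longrightarrow> p (t *\<^sub>R x) = t * p x"
  by (auto simp: sublinear_def)

lemma sublinear_zero: "sublinear p \<Longrightarrow> p 0 = 0"
  using sublinear_scale[of p 0 0] by simp

lemma sublinear_minus: "sublinear p \<Longrightarrow> - p (- x) \<le> p x"
  using sublinear_add[of p x "- x"] sublinear_zero[of p] by simp

text \<open>The infimum of \<open>p (x + t *\<^sub>R y) - t * p y\<close> over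
  \<open>t \<ge> 0\<close> is again sublinear. Taking \<open>t = 0\<close> puts it below
  \<open>p\<close>, and \<open>t = 1\<close> at \<open>- y\<close> gives the last bound. A minimal
  functional cannot be decreased in this way, which makes it odd.\<close>

lemma sublinear_decrease:
  assumes p: "sublinear p"
  obtains q where "sublinear q" "q \<le> p" "q (- y) \<le> - p y"
proof
  define g where "g x t = p (x + t *\<^sub>R y) - t * p y" for x t
  define q where "q x = (INF t\<in>{0..}. g x t)" for x
  have lower: "- p (- x) \<le> g x t" if "t \<ge> 0" for x t
    using sublinear_add[OF p, of "x + t *\<^sub>R y" "- x"] sublinear_scale[OF p that, of y]
    by (simp add: g_def algebra_simps)
  have bdd: "bdd_below (g x ` {0..})" for x
    using lower by (intro bdd_belowI2) auto
  have q_le: "q x \<le> g x t" if "t \<ge> 0" for x t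
    unfolding q_def using bdd that by (intro cINF_lower) auto
  have le_q: "c \<le> q x" if "\<And>t. t \<ge> 0 \<Longrightarrow> c \<le> g x t" for c x
    unfolding q_def using that by (intro cINF_greatest) auto
  show le: "q \<le> p"
    using q_le[of 0] by (simp add: le_fun_def g_def)
  show "q (- y) \<le> - p y"
    using q_le[of 1 "- y"] sublinear_zero[OF p] by (simp add: g_def)
  show "sublinear q"
  proof (rule sublinearI)
    fix x z
    \<comment> \<open>The parameters \<open>s\<close> for \<open>x\<close> and \<open>t\<close> for
      \<open>z\<close> combine to \<open>s + t\<close>; infima are then taken over one parameter at
      a time.\<close>
    have "q (x + z) - g x s \<le> g z t" if "s \<ge> 0" "t \<ge> 0" for s t
      using q_le[of "s + t" "x + z"] sublinear_add[OF p, of "x + s *\<^sub>R y" "z + t *\<^sub>R y"] that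
      by (simp add: g_def algebra_simps)
    then have "q (x + z) - q z \<le> g x s" if "s \<ge> 0" for s
      using le_q[of "q (x + z) - g x s" z] that by fastforce
    then show "q (x + z) \<le> q x + q z"
      using le_q[of "q (x + z) - q z" x] by simp
  next
    fix s :: real and x
    assume s: "s > 0"
    have "q (s *\<^sub>R x) / s \<le> g x t" if "t \<ge> 0" for t
    proof -
      have "g (s *\<^sub>R x) (s * t) = s * g x t"
        using sublinear_scale[OF p, of s "x + t *\<^sub>R y"] s
        by (simp add: g_def algebra_simps)
      with q_le[of "s * t" "s *\<^sub>R x"] s that show ?thesis
        by (simp add: field_simps)
    qed
    then show "q (s *\<^sub>R x) \<le> s * q x"
      using le_q[of "q (s *\<^sub>R x) / s" x] s by (simp add: field_simps)
  next
    have "0 \<le> q 0"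
      using lower[of _ 0] sublinear_zero[OF p] by (intro le_q) simp
    with le show "q 0 = 0"
      using sublinear_zero[OF p] by (auto simp: le_fun_def intro!: antisym dest: spec[of _ 0])
  qed
qed

text \<open>A minimal sublinear functional is odd, and odd sublinear functionals are linear.\<close>

theorem hahn_banach_sublinear:
  fixes p :: "'a::real_vector \<Rightarrow> real"
  assumes p: "sublinear p"
  obtains f where "linear f" "f \<le> p" "f y = p y"
proof -
  \<comment> \<open>Starting below \<open>p'\<close> instead of \<open>p\<close> forces
    \<open>f (- y) \<le> - p y\<close>; oddness of the minimal \<open>f\<close> turns this into
    \<open>p y \<le> f y\<close>.\<close>
  obtain p' where p': "sublinear p'" "p' \<le> p" "p' (- y) \<le> - p y"
    using sublinear_decrease[OF p] .
  define A where "A = {q. sublinear q \<and> q \<le> p'}"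
  have "\<exists>m\<in>A. \<forall>a\<in>A. m \<ge> a \<longrightarrow> a = m"
  proof (rule predicate_Zorn)
    show "partial_order_on A (relation_of (\<lambda>a b. a \<ge> b) A)"
      by (rule partial_order_on_relation_ofI) auto
  next
    fix C assume "C \<in> Chains (relation_of (\<lambda>a b. a \<ge> b) A)"
    then have CA: "C \<subseteq> A" and chain: "\<And>a b. a \<in> C \<Longrightarrow> b \<in> C \<Longrightarrow> a \<le> b \<or> b \<le> a"
      by (auto simp: Chains_def relation_of_def)
    show "\<exists>u\<in>A. \<forall>a\<in>C. a \<ge> u"
    proof (cases "C = {}")
      case True
      then show ?thesis using p' by (auto simp: A_def)
    next
      case False
      define u where "u x = (INF q\<in>C. q x)" for x
      have sub: "sublinear q" "q \<le> p'" if "q \<in> C" for q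
        using that CA by (auto simp: A_def)
      have bdd: "bdd_below ((\<lambda>q. q x) ` C)" for x
      proof (rule bdd_belowI2)
        fix q assume "q \<in> C"
        with sub[of q] sublinear_minus[of q x] show "- p' (- x) \<le> q x"
          by (simp add: le_fun_def) (metis dual_order.trans neg_le_iff_le)
      qed
      have u_le: "u x \<le> q x" if "q \<in> C" for q x
        unfolding u_def using bdd that by (intro cINF_lower) auto
      have le_u: "c \<le> u x" if "\<And>q. q \<in> C \<Longrightarrow> c \<le> q x" for c x
        unfolding u_def using that False by (intro cINF_greatest) auto
      have "sublinear u"
      proof (rule sublinearI)
        fix x y
        \<comment> \<open>Of two comparable members of the chain, the smaller one bounds
          \<open>u (x + y)\<close>, and its own subadditivity finishes.\<close>
        have "u (x + y) - q x \<le> r y" if qr: "q \<in> C" "r \<in> C" for q r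
        proof (cases "q \<le> r")
          case True
          then have "q y \<le> r y" by (simp add: le_fun_def)
          with u_le[OF qr(1), of "x + y"] sublinear_add[OF sub(1)[OF qr(1)], of x y]
          show ?thesis by simp
        next
          case False
          then have "r x \<le> q x" using chain[OF qr] by (auto simp: le_fun_def)
          with u_le[OF qr(2), of "x + y"] sublinear_add[OF sub(1)[OF qr(2)], of x y]
          show ?thesis by simp
        qed
        then have "u (x + y) - u y \<le> q x" if "q \<in> C" for q
          using le_u[of "u (x + y) - q x" y] that by fastforce
        then show "u (x + y) \<le> u x + u y"
          using le_u[of "u (x + y) - u y" x] by simp
      next
        fix t :: real and x assume t: "t > 0"
        have "u (t *\<^sub>R x) / t \<le> q x" if "q \<in> C" for q
          using u_le[OF that, of "t *\<^sub>R x"] sublinear_scale[OF sub(1)[OF that], of t x] t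
          by (simp add: field_simps)
        then show "u (t *\<^sub>R x) \<le> t * u x"
          using le_u[of "u (t *\<^sub>R x) / t" x] t by (simp add: field_simps)
      next
        show "u 0 = 0"
          using False sub by (simp add: u_def sublinear_zero)
      qed
      moreover have "u \<le> p'"
      proof -
        obtain q where "q \<in> C" using False by blast
        with u_le[of q] sub(2)[of q] show ?thesis by (auto simp: le_fun_def intro: order_trans)
      qed
      ultimately show ?thesis
        using u_le by (auto simp: A_def le_fun_def)
    qed
  qed
  then obtain f where f: "sublinear f" "f \<le> p'"
    and min: "\<And>q. sublinear q \<Longrightarrow> q \<le> f \<Longrightarrow> q = f"
    by (auto simp: A_def intro: order_trans)
  have odd: "f (- x) = - f x" for x
  proof (rule antisym)
    obtain q where "sublinear q" "q \<le> f" "q (- x) \<le> - f x"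
      using sublinear_decrease[OF f(1)] .
    with min show "f (- x) \<le> - f x" by blast
  qed (use sublinear_minus[OF f(1), of "- x"] in simp)
  show thesis
  proof
    show "linear f"
    proof (rule linearI)
      fix x y
      show "f (x + y) = f x + f y"
        using sublinear_add[OF f(1), of x y] sublinear_add[OF f(1), of "- x" "- y"] odd[of "x + y"]
        by (simp add: odd)
    next
      fix t x
      show "f (t *\<^sub>R x) = t *\<^sub>R f x"
        using sublinear_scale[OF f(1), of t x] sublinear_scale[OF f(1), of "- t" "- x"] odd
        by (cases "t \<ge> 0") auto
    qed
    show le: "f \<le> p" using f(2) p'(2) by (rule order_trans)
    have "f (- y) \<le> - p y"
      using f(2) p'(3) by (auto simp: le_fun_def intro: order_trans)
    with le odd show "f y = p y"
      by (simp add: le_fun_def antisym)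
  qed
qed

section \<open>Seminorms and dominated functionals over both scalar fields\<close>

definition seminorm_over :: "('k::real_normed_field \<Rightarrow> 'a::ab_group_add \<Rightarrow> 'a) \<Rightarrow> ('a \<Rightarrow> real) \<Rightarrow> bool"
  where "seminorm_over smul p \<longleftrightarrow>
    (\<forall>x y. p (x + y) \<le> p x + p y) \<and> (\<forall>c x. p (smul c x) = norm c * p x)"

lemma (in banach_space_over) seminorm_over_imp_sublinear: "seminorm_over smul p \<Longrightarrow> sublinear p"
  by (simp add: seminorm_over_def sublinear_def flip: smul_of_real)

lemma (in banach_space_over) seminorm_over_nonneg:
  assumes "seminorm_over smul p"
  shows "p x \<ge> 0"
proof -
  have "p (- x) = p x"
    using assms by (metis (no_types) seminorm_over_def norm_minus_cancel norm_one mult_1 scale_minus_left scale_one)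
  then show ?thesis
    using sublinear_minus[OF seminorm_over_imp_sublinear[OF assms], of x] by simp
qed

text \<open>Taking the Hahn-Banach property as an assumption lets the argument run once for both
  scalar fields; the next two lemmas discharge it. The class \<open>heine_borel\<close> supplies
  compactness of closed bounded sets of scalars.\<close>

locale hahn_banach_space = banach_space_over smul
  for smul :: "'k::{real_normed_field,banach,heine_borel} \<Rightarrow> 'b::banach \<Rightarrow> 'b" +
  assumes hahn_banach: "seminorm_over smul p \<Longrightarrow>
    \<exists>F. Vector_Spaces.linear smul (*) F \<and> (\<forall>v. norm (F v) \<le> p v) \<and> F y = of_real (p y)"

lemma hahn_banach_space_real: "hahn_banach_space (scaleR :: real \<Rightarrow> 'b::banach \<Rightarrow> 'b)"
proof -
  interpret banach_space_over "scaleR :: real \<Rightarrow> 'b \<Rightarrow> 'b"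
    by (rule banach_space_over_scaleR)
  show ?thesis
  proof
    fix p :: "'b \<Rightarrow> real" and y
    assume p: "seminorm_over scaleR p"
    obtain f where f: "linear f" "f \<le> p" "f y = p y"
      using hahn_banach_sublinear[OF seminorm_over_imp_sublinear[OF p]] .
    have neg: "p (- v) = p v" for v
      using p by (metis (no_types) seminorm_over_def norm_minus_cancel norm_one mult_1 scale_minus_left scale_one)
    have "\<bar>f v\<bar> \<le> p v" for v
      using f(2) neg[of v] linear_neg[OF f(1), of v] by (simp add: le_fun_def abs_le_iff) metis
    moreover have "Vector_Spaces.linear scaleR (*) f"
      using f(1) by (simp add: linear_def real_scaleR_def[abs_def])
    ultimately show "\<exists>F. Vector_Spaces.linear (*\<^sub>R) (*) F \<and> (\<forall>v. norm (F v) \<le> p v) \<and> F y = of_real (p y)"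
      using f(3) by auto
  qed
qed

text \<open>The real functional \<open>f\<close> is the real part of the complex functional that
  sends v to f(v) - i f(iv). Rotating v by a unimodular scalar makes this value real and
  nonnegative, so the bound by \<open>p\<close> passes from \<open>f\<close> to
  \<open>F\<close>.\<close>

lemma hahn_banach_space_complex:
  assumes "banach_space_over (smul :: complex \<Rightarrow> 'b::banach \<Rightarrow> 'b)"
  shows "hahn_banach_space smul"
proof -
  interpret banach_space_over smul by fact
  show ?thesis
  proof
    fix p :: "'b \<Rightarrow> real" and y
    assume p: "seminorm_over smul p"
    obtain f where f: "linear f" "f \<le> p" "f y = p y"
      using hahn_banach_sublinear[OF seminorm_over_imp_sublinear[OF p]] .
    define F where "F v = Complex (f v) (- f (smul \<i> v))" for v
    have decomp: "smul c v = Re c *\<^sub>R v + Im c *\<^sub>R smul \<i> v" for c v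
    proof -
      have "smul c v = smul (of_real (Re c) + of_real (Im c) * \<i>) v"
        using complex_eq[of c] by (simp add: mult.commute)
      then show ?thesis
        by (simp only: scale_left_distrib smul_of_real flip: scale_scale)
    qed
    have i2: "smul \<i> (smul \<i> v) = - v" for v
      by simp
    have fs: "f (smul c v) = Re c * f v + Im c * f (smul \<i> v)" for c v
      by (subst decomp) (simp add: linear_add[OF f(1)] linear_scale[OF f(1)])
    have F_scale: "F (smul c v) = c * F v" for c v
    proof -
      have "smul \<i> (smul c v) = smul c (smul \<i> v)"
        by (simp add: mult.commute)
      then have "f (smul \<i> (smul c v)) = Re c * f (smul \<i> v) - Im c * f v"
        by (simp only: fs[of c "smul \<i> v"] i2 linear_neg[OF f(1)])
      then show ?thesis
        unfolding F_def complex_eq_iff fs[of c v] by (simp del: scale_scale)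
    qed
    have F_lin: "Vector_Spaces.linear smul (*) F"
    proof unfold_locales
      show "F (u + v) = F u + F v" for u v
        by (simp add: F_def complex_eq_iff scale_right_distrib linear_add[OF f(1)])
    qed (rule F_scale)
    have F_le: "norm (F v) \<le> p v" for v
    proof (cases "F v = 0")
      case True
      then show ?thesis using seminorm_over_nonneg[OF p] by simp
    next
      case False
      define c where "c = of_real (norm (F v)) / F v"
      have c: "norm c = 1" using False by (simp add: c_def norm_divide)
      have "F (smul c v) = of_real (norm (F v))"
        using False by (simp add: F_scale c_def)
      then have "norm (F v) = f (smul c v)"
        by (simp add: F_def complex_eq_iff)
      also have "\<dots> \<le> p (smul c v)" using f(2) by (simp add: le_fun_def)
      also have "\<dots> = p v" using p c by (simp add: seminorm_over_def)
      finally show ?thesis .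
    qed
    \<comment> \<open>The real part already has the largest modulus that \<open>F_le\<close> allows,
      so the imaginary part vanishes.\<close>
    have "F y = of_real (p y)"
    proof -
      have "Re (F y) = p y" using f(3) by (simp add: F_def)
      moreover from this F_le[of y] seminorm_over_nonneg[OF p, of y] have "Im (F y) = 0"
        using cmod_power2[of "F y"] power_mono[of "norm (F y)" "p y" 2] by simp
      ultimately show ?thesis by (simp add: complex_eq_iff)
    qed
    with F_lin F_le show "\<exists>F. Vector_Spaces.linear smul (*) F \<and> (\<forall>v. norm (F v) \<le> p v) \<and> F y = of_real (p y)"
      by blast
  qed
qed

section \<open>Linear functionals and approximate preimages\<close>

text \<open>Finitely many functionals see only a finite-dimensional part of \<open>Z\<close>. In the
  induction, either \<open>\<psi>\<close> vanishes on the common kernel of the earlier functionals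
  in \<open>Z\<close> and \<open>B\<close> is kept, or a vector of that kernel with nonzero value
  under \<open>\<psi>\<close> is added; multiples of it correct that value without disturbing the
  others.\<close>

lemma (in vector_space) finite_span_interpolates:
  assumes "finite \<Phi>" and Z: "subspace Z"
    and lin: "\<And>\<phi>. \<phi> \<in> \<Phi> \<Longrightarrow> Vector_Spaces.linear scale (*) \<phi>"
  obtains B where "finite B" "B \<subseteq> Z" "\<And>z. z \<in> Z \<Longrightarrow> \<exists>s\<in>span B. \<forall>\<phi>\<in>\<Phi>. \<phi> s = \<phi> z"
proof -
  have "\<exists>B. finite B \<and> B \<subseteq> Z \<and> (\<forall>z\<in>Z. \<exists>s\<in>span B. \<forall>\<phi>\<in>\<Phi>. \<phi> s = \<phi> z)"
    using assms(1) lin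
  proof (induction \<Phi>)
    case empty
    show ?case by (rule exI[of _ "{}"]) auto
  next
    case (insert \<psi> \<Phi>)
    then obtain B where B: "finite B" "B \<subseteq> Z" and
      approx: "\<And>z. z \<in> Z \<Longrightarrow> \<exists>s\<in>span B. \<forall>\<phi>\<in>\<Phi>. \<phi> s = \<phi> z"
      by fastforce
    have hom: "module_hom scale (*) \<phi>" if "\<phi> \<in> insert \<psi> \<Phi>" for \<phi>
      using insert.prems[OF that] by (simp add: linear_iff_module_hom)
    show ?case
    proof (cases "\<forall>v\<in>Z. (\<forall>\<phi>\<in>\<Phi>. \<phi> v = 0) \<longrightarrow> \<psi> v = 0")
      case True
      have "\<exists>s\<in>span B. \<forall>\<phi>\<in>insert \<psi> \<Phi>. \<phi> s = \<phi> z" if z: "z \<in> Z" for z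
      proof -
        obtain s where s: "s \<in> span B" "\<And>\<phi>. \<phi> \<in> \<Phi> \<Longrightarrow> \<phi> s = \<phi> z"
          using approx[OF z] by blast
        moreover have "z - s \<in> Z"
          using s(1) z B(2) span_minimal[OF B(2) Z] by (auto intro: subspace_diff[OF Z])
        moreover have "\<phi> (z - s) = 0" if "\<phi> \<in> \<Phi>" for \<phi>
          using that s(2)[OF that] module_hom.diff[OF hom, of \<phi> z s] by simp
        ultimately have "\<psi> (z - s) = 0" using True by blast
        then have "\<psi> s = \<psi> z"
          using module_hom.diff[OF hom, of \<psi> z s] by simp
        with s show ?thesis by blast
      qed
      with B show ?thesis by blast
    next
      case False
      then obtain v where v: "v \<in> Z" "\<And>\<phi>. \<phi> \<in> \<Phi> \<Longrightarrow> \<phi> v = 0" "\<psi> v \<noteq> 0"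
        by blast
      have "\<exists>s\<in>span (insert v B). \<forall>\<phi>\<in>insert \<psi> \<Phi>. \<phi> s = \<phi> z" if z: "z \<in> Z" for z
      proof -
        obtain s where s: "s \<in> span B" "\<And>\<phi>. \<phi> \<in> \<Phi> \<Longrightarrow> \<phi> s = \<phi> z"
          using approx[OF z] by blast
        let ?a = "(\<psi> z - \<psi> s) / \<psi> v"
        have "s + scale ?a v \<in> span (insert v B)"
          using s(1) span_mono[of B "insert v B"]
          by (intro span_add span_scale) (auto intro: span_base)
        moreover have eq: "\<phi> (s + scale ?a v) = \<phi> s + ?a * \<phi> v" if "\<phi> \<in> insert \<psi> \<Phi>" for \<phi>
          using module_hom.add[OF hom[OF that]] module_hom.scale[OF hom[OF that]] by simp
        moreover have "\<psi> (s + scale ?a v) = \<psi> z"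
          using eq[of \<psi>] v(3) by simp
        moreover have "\<phi> (s + scale ?a v) = \<phi> z" if "\<phi> \<in> \<Phi>" for \<phi>
          using eq[of \<phi>] s(2)[OF that] v(2)[OF that] that by simp
        ultimately show ?thesis by blast
      qed
      with B v(1) show ?thesis by (intro exI[of _ "insert v B"]) auto
    qed
  qed
  then show thesis using that by blast
qed

section \<open>Infimal convolutions, combinations of functionals, separation\<close>

lemma seminorm_over_add: "seminorm_over s p \<Longrightarrow> p (x + y) \<le> p x + p y"
  and seminorm_over_scale: "seminorm_over s p \<Longrightarrow> p (s c x) = norm c * p x"
  by (auto simp: seminorm_over_def)

context banach_space_over
begin

lemma seminorm_over_zero: "seminorm_over smul p \<Longrightarrow> p 0 = 0"
  using seminorm_over_imp_sublinear sublinear_zero by blast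

lemma seminorm_over_norm: "seminorm_over smul norm"
  by (simp add: seminorm_over_def norm_smul norm_triangle_ineq)

text \<open>\<open>p\<close> is the infimal convolution of \<open>q\<close> with the image of
  \<open>r\<close> under \<open>T\<close>. For \<open>r = 0\<close>, \<open>q\<close> the norm and
  \<open>T\<close> the identity it is the distance to \<open>A\<close>; for \<open>r\<close> the
  norm and \<open>A\<close> the whole space it measures how well \<open>v\<close> is approximated by
  some \<open>T x\<close> with small \<open>x\<close>.\<close>

lemma seminorm_over_INF:
  assumes X: "banach_space_over sX" and A: "module.subspace sX A"
    and T: "Vector_Spaces.linear sX smul T"
    and r: "seminorm_over sX r" and q: "seminorm_over smul q"
  defines "p \<equiv> \<lambda>v. INF x\<in>A. r x + q (v - T x)"
  shows "seminorm_over smul p" and "\<And>x v. x \<in> A \<Longrightarrow> p v \<le> r x + q (v - T x)"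
proof -
  interpret X: banach_space_over sX by fact
  interpret T: module_hom sX smul T using T by (simp add: linear_iff_module_hom)
  have nonneg: "0 \<le> r x + q w" for x w
    using X.seminorm_over_nonneg[OF r] seminorm_over_nonneg[OF q] by (simp add: add_nonneg_nonneg)
  have "bdd_below ((\<lambda>x. r x + q (v - T x)) ` A)" for v
    using nonneg by (intro bdd_belowI2[where m = 0]) auto
  then show p_le: "p v \<le> r x + q (v - T x)" if "x \<in> A" for x v
    unfolding p_def using that by (intro cINF_lower) auto
  have zero: "0 \<in> A" using A by (rule X.subspace_0)
  then have le_p: "b \<le> p v" if "\<And>x. x \<in> A \<Longrightarrow> b \<le> r x + q (v - T x)" for b v
    unfolding p_def using that by (intro cINF_greatest) auto
  have add: "p (v + w) \<le> p v + p w" for v w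
  proof -
    have "p (v + w) - (r x + q (v - T x)) \<le> r x' + q (w - T x')" if "x \<in> A" "x' \<in> A" for x x'
    proof -
      have "p (v + w) \<le> r (x + x') + q ((v - T x) + (w - T x'))"
        using p_le[of "x + x'" "v + w"] that A by (simp add: X.subspace_add T.add algebra_simps)
      with seminorm_over_add[OF r, of x x'] seminorm_over_add[OF q, of "v - T x" "w - T x'"]
      show ?thesis by simp
    qed
    then have "p (v + w) - p w \<le> r x + q (v - T x)" if "x \<in> A" for x
      using le_p[of "p (v + w) - (r x + q (v - T x))" w] that by fastforce
    then show ?thesis using le_p[of "p (v + w) - p w" v] by simp
  qed
  have scale_le: "p (smul c v) \<le> norm c * p v" if c: "c \<noteq> 0" for c v
  proof -
    have "p (smul c v) / norm c \<le> r x + q (v - T x)" if "x \<in> A" for x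
    proof -
      have "p (smul c v) \<le> r (sX c x) + q (smul c (v - T x))"
        using p_le[of "sX c x" "smul c v"] that A
        by (simp add: X.subspace_scale T.scale scale_right_diff_distrib)
      also have "\<dots> = (r x + q (v - T x)) * norm c"
        by (simp only: seminorm_over_scale[OF r] seminorm_over_scale[OF q]) (simp add: algebra_simps)
      finally show ?thesis using c by (simp add: divide_le_eq)
    qed
    then show ?thesis using le_p[of "p (smul c v) / norm c" v] c by (simp add: divide_le_eq mult.commute)
  qed
  have scale: "p (smul c v) = norm c * p v" for c v
  proof (cases "c = 0")
    case True
    have "p 0 = 0"
    proof (rule antisym)
      show "p 0 \<le> 0"
        using p_le[OF zero, of 0] by (simp add: X.seminorm_over_zero[OF r] seminorm_over_zero[OF q])
    qed (rule le_p[OF nonneg])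
    then show ?thesis using True by simp
  next
    case False
    have "norm c * p v \<le> p (smul c v)"
      using scale_le[of "inverse c" "smul c v"] False
      by (simp add: norm_divide inverse_eq_divide le_divide_eq mult.commute)
    with scale_le[OF False, of v] show ?thesis by simp
  qed
  show "seminorm_over smul p"
    using add scale by (simp add: seminorm_over_def)
qed

lemma dual_space_smul:
  fixes f :: "'a \<Rightarrow>\<^sub>L 'k"
  shows "f \<in> dual_space smul \<Longrightarrow> f (smul c v) = c * f v"
  by (simp add: dual_space_def linear_iff_module_hom module_hom.scale)

lemma dual_spaceI:
  fixes f :: "'a \<Rightarrow>\<^sub>L 'k"
  assumes "\<And>c v. f (smul c v) = c * f v"
  shows "f \<in> dual_space smul"
proof -
  have "Vector_Spaces.linear smul (*) f"
    by unfold_locales (auto simp: assms blinfun.add_right algebra_simps)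
  then show ?thesis by (simp add: dual_space_def)
qed

end

lemma dual_scale_apply [simp]: "blinfun_apply (dual_scale c f) v = c * f v"
  by (simp add: dual_scale_def)

lemma dual_map_apply [simp]: "blinfun_apply (dual_map T f) v = f (T v)"
  by (simp add: dual_map_def)

locale banach_space_over_complete = banach_space_over smul
  for smul :: "'k::{real_normed_field,banach} \<Rightarrow> 'b::banach \<Rightarrow> 'b"
begin

sublocale dual: banach_space_over "dual_scale :: 'k \<Rightarrow> ('b \<Rightarrow>\<^sub>L 'k) \<Rightarrow> ('b \<Rightarrow>\<^sub>L 'k)"
  by (rule banach_space_over_dual_scale)

lemma subspace_dual_space: "dual.subspace (dual_space smul)"
  by (auto simp: dual.subspace_def dual_space_smul blinfun.bilinear_simps algebra_simps
      intro!: dual_spaceI)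

text \<open>A functional that vanishes on the common kernel of finitely many others is a linear
  combination of them: subtracting a suitable multiple of one of them reduces their number.\<close>

lemma mem_subspace_if_kernels_subset:
  fixes f :: "'b \<Rightarrow>\<^sub>L 'k"
  assumes "finite B" "B \<subseteq> Z" and Z: "Z \<subseteq> dual_space smul" "dual.subspace Z"
    and "f \<in> dual_space smul" "\<And>v. (\<And>z. z \<in> B \<Longrightarrow> z v = 0) \<Longrightarrow> f v = 0"
  shows "f \<in> Z"
  using assms(1,2,5,6)
proof (induction B arbitrary: f)
  case empty
  then have "f = 0" by (intro blinfun_eqI) simp
  with Z show ?case by (simp add: dual.subspace_0)
next
  case (insert z B)
  show ?case
  proof (cases "\<forall>v. (\<forall>w\<in>B. w v = 0) \<longrightarrow> z v = 0")
    case True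
    then have "f v = 0" if "\<And>w. w \<in> B \<Longrightarrow> w v = 0" for v
      using that by (intro insert.prems(3)) auto
    with insert.IH insert.prems(1,2) show ?thesis by simp
  next
    case False
    then obtain v where v: "\<And>w. w \<in> B \<Longrightarrow> w v = 0" "z v \<noteq> 0" by blast
    have dual: "w \<in> dual_space smul" if "w \<in> insert z B" for w
      using that insert.prems(1) Z(1) by blast
    let ?g = "dual_scale (f v / z v) z"
    have "?g \<in> Z" using insert.prems(1) Z(2) by (simp add: dual.subspace_scale)
    moreover have "f - ?g \<in> Z"
    proof (rule insert.IH)
      show "B \<subseteq> Z" using insert.prems by simp
      show "f - ?g \<in> dual_space smul"
        using insert.prems(2) dual[of z] subspace_dual_space
        by (intro dual.subspace_diff dual.subspace_scale) auto
    next
      fix u assume u: "\<And>w. w \<in> B \<Longrightarrow> w u = 0"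
      \<comment> \<open>This moves \<open>u\<close> along \<open>v\<close> into the kernel of
        \<open>z\<close>; as \<open>B\<close> annihilates \<open>v\<close>, the other kernels are
        not left.\<close>
      let ?u = "u - smul (z u / z v) v"
      have "w ?u = w u - z u / z v * w v" if "w \<in> dual_space smul" for w :: "'b \<Rightarrow>\<^sub>L 'k"
        using that by (simp add: blinfun.bilinear_simps dual_space_smul)
      with u v dual have "w ?u = 0" if "w \<in> insert z B" for w
        using that by auto
      then have "f ?u = 0" by (rule insert.prems(3))
      then show "(f - ?g) u = 0"
        using insert.prems(2) by (simp add: blinfun.bilinear_simps dual_space_smul)
    qed
    ultimately show ?thesis using Z(2) dual.subspace_add by fastforce
  qed
qed

end

sublocale hahn_banach_space \<subseteq> banach_space_over_complete ..

context hahn_banach_space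
begin

lemma hahn_banach_dual_space:
  assumes p: "seminorm_over smul p" and K: "\<And>v. p v \<le> K * norm v"
  obtains f :: "'b \<Rightarrow>\<^sub>L 'k" where "f \<in> dual_space smul" "\<And>v. norm (f v) \<le> p v" "f y = of_real (p y)"
proof -
  obtain F where F: "Vector_Spaces.linear smul (*) F" "\<And>v. norm (F v) \<le> p v" "F y = of_real (p y)"
    using hahn_banach[OF p, of y] by blast
  interpret F: module_hom smul "(*)" F using F(1) by (simp add: linear_iff_module_hom)
  have "bounded_linear F"
  proof (rule bounded_linear_intro)
    show "F (r *\<^sub>R v) = r *\<^sub>R F v" for r v
      by (metis F.scale smul_of_real scaleR_conv_of_real)
    show "norm (F v) \<le> norm v * K" for v
      using F(2)[of v] K[of v] by (simp add: mult.commute)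
  qed (rule F.add)
  then show thesis
    using F by (intro that[of "Blinfun F"]) (auto simp: dual_space_def bounded_linear_Blinfun_apply)
qed

text \<open>Hahn-Banach is applied to the distance from \<open>M\<close>, which vanishes on
  \<open>M\<close> and is nonzero at \<open>y\<close> because \<open>M\<close> is closed.\<close>

lemma closed_subspace_separation:
  assumes M: "subspace M" "closed M" and "y \<notin> M"
  obtains f :: "'b \<Rightarrow>\<^sub>L 'k" where "f \<in> dual_space smul" "\<And>m. m \<in> M \<Longrightarrow> f m = 0" "f y \<noteq> 0"
proof -
  define p where "p = (\<lambda>v. INF m\<in>M. (\<lambda>_. 0) m + norm (v - (\<lambda>m. m) m))"
  have "Vector_Spaces.linear smul smul (\<lambda>m. m)" by unfold_locales auto
  moreover have "seminorm_over smul (\<lambda>_. 0)" by (simp add: seminorm_over_def)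
  ultimately have p: "seminorm_over smul p" "\<And>m v. m \<in> M \<Longrightarrow> p v \<le> norm (v - m)"
    using seminorm_over_INF[OF banach_space_over_axioms M(1) _ _ seminorm_over_norm]
    unfolding p_def by fastforce+
  have zero: "0 \<in> M" using M(1) by (rule subspace_0)
  have "p v \<le> 1 * norm v" for v using p(2)[OF zero] by simp
  from hahn_banach_dual_space[OF p(1) this]
  obtain f :: "'b \<Rightarrow>\<^sub>L 'k" where f: "f \<in> dual_space smul" "\<And>v. norm (f v) \<le> p v" "f y = of_real (p y)"
    by blast
  show thesis
  proof
    show "f m = 0" if "m \<in> M" for m
      using order_trans[OF f(2) p(2)[OF that, of m]] by simp
    have "p y = infdist y M"
      using zero by (auto simp: p_def infdist_def dist_norm)
    with assms zero have "p y \<noteq> 0"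
      using in_closed_iff_infdist_zero[of M y] by auto
    with f(3) show "f y \<noteq> 0" by simp
  qed (fact f(1))
qed

end

section \<open>Approximate preimages when the adjoint is bounded below\<close>

locale hahn_banach_operator =
  hahn_banach_space smul + X: banach_space_over smulX
  for smul :: "'k::{real_normed_field,banach,heine_borel} \<Rightarrow> 'b::banach \<Rightarrow> 'b"
    and smulX :: "'k \<Rightarrow> 'a::banach \<Rightarrow> 'a" +
  fixes T :: "'a \<Rightarrow>\<^sub>L 'b"
  assumes linear_T: "Vector_Spaces.linear smulX smul T"
begin

text \<open>A functional in \<open>Z\<close> whose image under the adjoint has norm at most 1 has
  norm at most \<open>1 / c\<close>; by Hahn-Banach this bounds the cost of approximating
  \<open>y\<close>. The summand 1 makes the bound strict, so that some \<open>x\<close> realises a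
  cost below it.\<close>

lemma approx_preimage:
  assumes Z: "Z \<subseteq> dual_space smul" "dual.subspace Z"
    and c: "c > 0" "\<And>z :: 'b \<Rightarrow>\<^sub>L 'k. z \<in> Z \<Longrightarrow> c * norm z \<le> norm (dual_map T z)"
    and B: "finite B" "B \<subseteq> Z" and "\<epsilon> > 0"
  obtains x where "norm x \<le> norm y / c + 1" "\<And>z. z \<in> B \<Longrightarrow> norm (z (T x - y)) \<le> \<epsilon>"
proof -
  define L where "L = norm y / c + 1"
  have L: "L > 0" using c(1) by (simp add: L_def add_nonneg_pos)
  txt \<open>A functional dominated by the infimal convolution \<open>p\<close> below lies in the span of \<open>B\<close> and
    satisfies \<open>\<parallel>T\<^sup>* f\<parallel> \<le> 1\<close>, so \<open>p y \<le> \<parallel>y\<parallel> / c\<close>.\<close>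
  define q where "q v = (L / \<epsilon>) * (\<Sum>z\<in>B. norm (blinfun_apply z v))" for v
  have q: "seminorm_over smul q"
    unfolding seminorm_over_def
  proof (intro conjI allI)
    fix v w :: 'b and a :: 'k
    have "(\<Sum>z\<in>B. norm (blinfun_apply z (v + w))) \<le> (\<Sum>z\<in>B. norm (blinfun_apply z v)) + (\<Sum>z\<in>B. norm (blinfun_apply z w))"
      unfolding sum.distrib[symmetric]
      by (intro sum_mono) (simp add: blinfun.add_right norm_triangle_ineq)
    then show "q (v + w) \<le> q v + q w"
      unfolding q_def distrib_left[symmetric] using L \<open>\<epsilon> > 0\<close> by (intro mult_left_mono) auto
    have "z (smul a v) = a * z v" if "z \<in> B" for z
      using that B(2) Z(1) by (intro dual_space_smul) auto
    then show "q (smul a v) = norm a * q v"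
      by (simp add: q_def norm_mult flip: sum_distrib_left)
  qed
  define p where "p = (\<lambda>v. INF x\<in>UNIV. norm x + q (v - T x))"
  have p: "seminorm_over smul p" "\<And>x v. p v \<le> norm x + q (v - T x)"
    unfolding p_def using seminorm_over_INF[OF X.banach_space_over_axioms X.subspace_UNIV linear_T
        X.seminorm_over_norm q] by auto
  have p_le_q: "p v \<le> q v" for v using p(2)[of v 0] by simp
  have "p v \<le> (L / \<epsilon> * (\<Sum>z\<in>B. norm z)) * norm v" for v
  proof -
    have "(\<Sum>z\<in>B. norm (blinfun_apply z v)) \<le> (\<Sum>z\<in>B. norm z) * norm v"
      unfolding sum_distrib_right by (intro sum_mono norm_blinfun)
    then have "q v \<le> (L / \<epsilon> * (\<Sum>z\<in>B. norm z)) * norm v"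
      unfolding q_def mult.assoc using L \<open>\<epsilon> > 0\<close> by (intro mult_left_mono) auto
    with p_le_q[of v] show ?thesis by simp
  qed
  then obtain f :: "'b \<Rightarrow>\<^sub>L 'k" where f: "f \<in> dual_space smul" "\<And>v. norm (f v) \<le> p v" "f y = of_real (p y)"
    using hahn_banach_dual_space[OF p(1)] by blast
  have "f \<in> Z"
  proof (rule mem_subspace_if_kernels_subset[OF B Z f(1)])
    fix v assume "\<And>z. z \<in> B \<Longrightarrow> z v = 0"
    then have "q v = 0" by (simp add: q_def)
    with p_le_q[of v] order_trans[OF f(2) p_le_q, of v] show "f v = 0" by simp
  qed
  have "norm (dual_map T f) \<le> 1"
  proof (rule norm_blinfun_bound)
    fix x
    show "norm (dual_map T f x) \<le> 1 * norm x"
      using f(2)[of "T x"] p(2)[of "T x" x] seminorm_over_zero[OF q] by simp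
  qed simp
  with c(2)[OF \<open>f \<in> Z\<close>] have nf: "norm f \<le> 1 / c"
    using c(1) by (simp add: field_simps)
  have "p y \<le> norm (f y)" using f(3) by simp
  also have "\<dots> \<le> norm f * norm y" by (rule norm_blinfun)
  also have "\<dots> \<le> 1 / c * norm y" using nf by (intro mult_right_mono) auto
  also have "\<dots> < L" by (simp add: L_def)
  finally have "(INF x\<in>UNIV. norm x + q (y - T x)) < L" by (simp add: p_def)
  then obtain x where x: "norm x + q (y - T x) < L"
    using cInf_lessD[of "range (\<lambda>x. norm x + q (y - T x))" L] by blast
  have q_nonneg: "q v \<ge> 0" for v
    using seminorm_over_nonneg[OF q] .
  show thesis
  proof
    show "norm x \<le> norm y / c + 1"
      using x q_nonneg[of "y - T x"] by (simp add: L_def)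
    fix z assume "z \<in> B"
    then have "norm (z (y - T x)) \<le> (\<Sum>z\<in>B. norm (blinfun_apply z (y - T x)))"
      using B(1) by (intro member_le_sum) auto
    \<comment> \<open>The weight in \<open>q\<close> was chosen so that a total below
      \<open>L\<close> leaves each error below \<open>\<epsilon>\<close>.\<close>
    moreover have "L / \<epsilon> * (\<Sum>z\<in>B. norm (blinfun_apply z (y - T x))) < L"
      using x norm_ge_zero[of x] unfolding q_def by linarith
    ultimately show "norm (z (T x - y)) \<le> \<epsilon>"
      using L \<open>\<epsilon> > 0\<close> by (simp add: field_simps blinfun.diff_right norm_minus_commute)
  qed
qed

text \<open>The values of the finitely many functionals on the ball are totally bounded. The ball
  thus splits into finitely many classes of points with nearly equal values, and one approximate
  preimage per class suffices.\<close>

lemma finite_approx_preimages: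
  assumes Z: "Z \<subseteq> dual_space smul" "dual.subspace Z"
    and c: "c > 0" "\<And>z :: 'b \<Rightarrow>\<^sub>L 'k. z \<in> Z \<Longrightarrow> c * norm z \<le> norm (dual_map T z)"
    and B: "finite B" "B \<subseteq> Z" and "\<epsilon> > 0"
  obtains F where "finite F" "\<And>u. u \<in> F \<Longrightarrow> norm u \<le> r / c + 1"
    "\<And>y. norm y \<le> r \<Longrightarrow> \<exists>u\<in>F. \<forall>z\<in>B. norm (z (T u - y)) \<le> \<epsilon>"
proof -
  have "\<exists>k. finite k \<and> blinfun_apply z ` cball 0 r \<subseteq> (\<Union>a\<in>k. ball a (\<epsilon> / 4))" for z :: "'b \<Rightarrow>\<^sub>L 'k"
  proof -
    have "bounded (blinfun_apply z ` cball 0 r)"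
      by (intro bounded_linear_image blinfun.bounded_linear_right) simp
    then have "compact (closure (blinfun_apply z ` cball 0 r))"
      by simp
    then have "\<exists>k. finite k \<and> closure (blinfun_apply z ` cball 0 r) \<subseteq> (\<Union>a\<in>k. ball a (\<epsilon> / 4))"
      using \<open>\<epsilon> > 0\<close> by (simp add: compact_eq_totally_bounded)
    then show ?thesis using closure_subset by (meson order_trans)
  qed
  then have "\<forall>z :: 'b \<Rightarrow>\<^sub>L 'k. \<exists>k. finite k \<and> blinfun_apply z ` cball 0 r \<subseteq> (\<Union>a\<in>k. ball a (\<epsilon> / 4))"
    by blast
  from choice[OF this] obtain k where
    "\<forall>z :: 'b \<Rightarrow>\<^sub>L 'k. finite (k z) \<and> blinfun_apply z ` cball 0 r \<subseteq> (\<Union>a\<in>k z. ball a (\<epsilon> / 4))" ..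
  then have k: "finite (k z)" "blinfun_apply z ` cball 0 r \<subseteq> (\<Union>a\<in>k z. ball a (\<epsilon> / 4))"
    for z :: "'b \<Rightarrow>\<^sub>L 'k"
    by simp_all
  have "\<exists>a. norm y \<le> r \<longrightarrow> a \<in> k z \<and> dist a (z y) < \<epsilon> / 4" for y and z :: "'b \<Rightarrow>\<^sub>L 'k"
  proof (cases "norm y \<le> r")
    case True
    then have "z y \<in> (\<Union>a\<in>k z. ball a (\<epsilon> / 4))"
      using k(2)[of z] by (simp add: image_subset_iff)
    then show ?thesis by auto
  qed simp
  then obtain cell where cell: "cell y z \<in> k z" "dist (cell y z) (z y) < \<epsilon> / 4"
    if "norm y \<le> r" for y and z :: "'b \<Rightarrow>\<^sub>L 'k"
    by metis
  define g where "g y = restrict (cell y) B" for y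
  have "g ` cball 0 r \<subseteq> (\<Pi>\<^sub>E z\<in>B. k z)"
    using cell(1) by (auto simp: g_def)
  then have "finite (g ` cball 0 r)"
    using B(1) k(1) by (meson finite_PiE finite_subset)
  \<comment> \<open>\<open>C\<close> holds one representative for each pattern of cells that
    occurs.\<close>
  then obtain C where C: "C \<subseteq> cball 0 r" "finite C" "g ` cball 0 r = g ` C"
    using finite_subset_image[of "g ` cball 0 r" g "cball 0 r"] by blast
  have "\<exists>x. norm x \<le> norm s / c + 1 \<and> (\<forall>z\<in>B. norm (z (T x - s)) \<le> \<epsilon> / 2)" for s
    using approx_preimage[OF Z c B half_gt_zero[OF \<open>\<epsilon> > 0\<close>], of s] by metis
  then obtain u where u: "\<And>s. norm (u s) \<le> norm s / c + 1"
      "\<And>s z. z \<in> B \<Longrightarrow> norm (z (T (u s) - s)) \<le> \<epsilon> / 2"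
    by metis
  show thesis
  proof
    show "finite (u ` C)" using C(2) by simp
    show "norm x \<le> r / c + 1" if x: "x \<in> u ` C" for x
    proof -
      obtain s where s: "s \<in> C" "x = u s" using x by blast
      then have "norm s / c \<le> r / c"
        using C(1) c(1) by (intro divide_right_mono) auto
      with u(1)[of s] s(2) show ?thesis by simp
    qed
  next
    fix y :: 'b assume y: "norm y \<le> r"
    then have "g y \<in> g ` C" using C(3) by auto
    then obtain s where s: "s \<in> C" "g s = g y" by force
    then have ns: "norm s \<le> r" using C(1) by auto
    have "norm (z (T (u s) - y)) \<le> \<epsilon>" if z: "z \<in> B" for z
    proof -
      have "cell s z = cell y z" using fun_cong[OF s(2), of z] z by (simp add: g_def)
      \<comment> \<open>Points with the same pattern share a cell of radius
        \<open>\<epsilon> / 4\<close>; the other half of \<open>\<epsilon>\<close> pays for the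
        approximate preimage of \<open>s\<close>.\<close>
      then have "dist (z s) (z y) < \<epsilon> / 2"
        using cell(2)[OF ns, of z] cell(2)[OF y, of z] dist_triangle_half_r[of "cell s z" "z s" "\<epsilon> / 2" "z y"]
        by (simp add: dist_commute)
      moreover have "z (T (u s) - y) = z (T (u s) - s) + (z s - z y)"
        by (simp add: blinfun.bilinear_simps)
      ultimately show ?thesis
        using u(2)[OF z, of s] norm_triangle_ineq[of "z (T (u s) - s)" "z s - z y"]
        by (simp add: dist_norm)
    qed
    then show "\<exists>v\<in>u ` C. \<forall>z\<in>B. norm (z (T v - y)) \<le> \<epsilon>" using s(1) by blast
  qed
qed

end

section \<open>Surjectivity modulo a closed subspace\<close>

text \<open>Cosets and limits involve only the real structure, so the facts below are stated for
  real subspaces and serve both scalar fields.\<close>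

lemma (in banach_space_over) subspace_imp_real_subspace: "subspace M \<Longrightarrow> real_vector.subspace M"
  by (metis real_vector.subspace_def smul_of_real subspace_def)

text \<open>As in the open mapping theorem, the approximate solution is iterated on the remainder.
  The remainder halves each time, so the corrections form an absolutely convergent series.\<close>

lemma solvable_mod_if_approx:
  fixes T :: "'a::banach \<Rightarrow>\<^sub>L 'b::banach"
  assumes M: "real_vector.subspace M" "closed M"
    and approx: "\<And>y. norm y \<le> 1 \<Longrightarrow> \<exists>x. norm x \<le> C \<and> (\<exists>m\<in>M. norm (y - T x - m) \<le> 1 / 2)"
  shows "\<exists>x. y - T x \<in> M"
proof -
  have "\<exists>x m. norm x \<le> C * norm y \<and> m \<in> M \<and> norm (y - T x - m) \<le> norm y / 2" for y
  proof (cases "y = 0")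
    case True
    then show ?thesis
      using real_vector.subspace_0[OF M(1)] by (intro exI[of _ 0]) simp
  next
    case False
    let ?a = "norm y"
    have "norm (y /\<^sub>R ?a) \<le> 1" using False by simp
    then obtain x m where xm: "norm x \<le> C" "m \<in> M" "norm (y /\<^sub>R ?a - T x - m) \<le> 1 / 2"
      using approx by blast
    have "y - T (?a *\<^sub>R x) - ?a *\<^sub>R m = ?a *\<^sub>R (y /\<^sub>R ?a - T x - m)"
      using False by (simp add: blinfun.scaleR_right algebra_simps)
    then have "norm (y - T (?a *\<^sub>R x) - ?a *\<^sub>R m) = ?a * norm (y /\<^sub>R ?a - T x - m)"
      by simp
    also have "\<dots> \<le> ?a * (1 / 2)" by (intro mult_left_mono xm(3)) simp
    finally have "norm (y - T (?a *\<^sub>R x) - ?a *\<^sub>R m) \<le> ?a / 2" by simp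
    moreover have "norm (?a *\<^sub>R x) \<le> C * norm y"
      using mult_left_mono[OF xm(1), of ?a] by (simp add: mult.commute)
    ultimately show ?thesis
      using xm(2) real_vector.subspace_scale[OF M(1)] by blast
  qed
  then obtain g h where g: "\<And>y. norm (g y) \<le> C * norm y" and h: "\<And>y. h y \<in> M"
    and gh: "\<And>y. norm (y - T (g y) - h y) \<le> norm y / 2"
    by metis
  define r where "r = rec_nat y (\<lambda>_ v. v - T (g v) - h v)"
  have r_0: "r 0 = y" and r_Suc: "r (Suc n) = r n - T (g (r n)) - h (r n)" for n
    by (simp_all add: r_def)
  have norm_r: "norm (r n) \<le> norm y * (1 / 2) ^ n" for n
  proof (induction n)
    case (Suc n)
    then show ?case using gh[of "r n"] by (simp add: r_Suc)
  qed (simp add: r_0)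
  have "C * norm y \<ge> 0" using norm_ge_zero g order_trans by metis
  then have C: "C \<ge> 0 \<or> y = 0" by (auto simp: zero_le_mult_iff)
  have "summable (\<lambda>n. g (r n))"
  proof (rule summable_comparison_test')
    show "summable (\<lambda>n. C * norm y * (1 / 2) ^ n)"
      by (intro summable_mult summable_geometric) simp
    show "norm (g (r n)) \<le> C * norm y * (1 / 2) ^ n" for n
    proof (cases "y = 0")
      case True
      then show ?thesis using norm_r[of n] g[of 0] by simp
    next
      case False
      then show ?thesis
        using g[of "r n"] mult_left_mono[OF norm_r[of n], of C] C by (simp add: mult.assoc)
    qed
  qed
  then have "(\<lambda>n. \<Sum>i<n. g (r i)) \<longlonglongrightarrow> (\<Sum>n. g (r n))" by (rule summable_LIMSEQ)
  then have "(\<lambda>n. T (\<Sum>i<n. g (r i))) \<longlonglongrightarrow> T (\<Sum>n. g (r n))"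
    by (rule bounded_linear.tendsto[OF blinfun.bounded_linear_right])
  moreover have "r \<longlonglongrightarrow> 0"
  proof (rule Lim_null_comparison)
    show "\<forall>\<^sub>F n in sequentially. norm (r n) \<le> norm y * (1 / 2) ^ n" using norm_r by simp
    show "(\<lambda>n. norm y * (1 / 2) ^ n) \<longlonglongrightarrow> 0"
      by (intro tendsto_mult_right_zero LIMSEQ_power_zero) simp
  qed
  ultimately have "(\<lambda>n. y - T (\<Sum>i<n. g (r i)) - r n) \<longlonglongrightarrow> y - T (\<Sum>n. g (r n)) - 0"
    by (intro tendsto_diff tendsto_const)
  \<comment> \<open>The sum telescopes: what is left of \<open>y\<close> after \<open>n\<close>
    rounds, apart from the remainder, is the part absorbed by \<open>M\<close>. Closedness of
    \<open>M\<close> then allows the limit.\<close>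
  moreover have "y - T (\<Sum>i<n. g (r i)) - r n = (\<Sum>i<n. h (r i))" for n
    by (induction n) (simp_all add: r_0 r_Suc blinfun.add_right algebra_simps)
  moreover have "(\<Sum>i<n. h (r i)) \<in> M" for n
    using h by (intro real_vector.subspace_sum[OF M(1)])
  ultimately have "y - T (\<Sum>n. g (r n)) \<in> M"
    using closed_sequentially[OF M(2), of "\<lambda>n. \<Sum>i<n. h (r i)"] by simp
  then show ?thesis ..
qed

section \<open>Cosets and codimension\<close>

lemma quotient_map_mod_eq_iff:
  assumes M: "real_vector.subspace M"
  shows "quotient_map_mod M y = quotient_map_mod M z \<longleftrightarrow> y - z \<in> M"
proof
  assume "quotient_map_mod M y = quotient_map_mod M z"
  then have "y \<in> z +o M"
    using real_vector.subspace_0[OF M] by (force simp: quotient_map_mod_def elt_set_plus_def)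
  then show "y - z \<in> M" by (auto simp: elt_set_plus_def)
next
  assume yz: "y - z \<in> M"
  have "y + m = z + ((y - z) + m)" "z + m = y + (m - (y - z))" for m by simp_all
  then show "quotient_map_mod M y = quotient_map_mod M z"
    using real_vector.subspace_add[OF M yz] real_vector.subspace_diff[OF M _ yz]
    unfolding quotient_map_mod_def elt_set_plus_def by blast
qed

text \<open>With the two lemmas that follow, this replaces equalities between sets of cosets by
  solvability modulo \<open>M\<close>.\<close>

lemma image_quotient_map_mod_eq_iff:
  assumes M: "real_vector.subspace M"
  shows "quotient_map_mod M ` S = quotient_mod M \<longleftrightarrow> (\<forall>y. \<exists>s\<in>S. y - s \<in> M)"
proof -
  have "quotient_map_mod M ` S = quotient_mod M \<longleftrightarrow>
      (\<forall>y. \<exists>s\<in>S. quotient_map_mod M y = quotient_map_mod M s)"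
    unfolding quotient_mod_def by blast
  then show ?thesis by (simp add: quotient_map_mod_eq_iff[OF M])
qed

lemma range_quotient_map_mod_comp_eq_iff:
  assumes M: "real_vector.subspace M"
  shows "range (quotient_map_mod M \<circ> f) = quotient_mod M \<longleftrightarrow> (\<forall>y. \<exists>x. y - f x \<in> M)"
  unfolding image_comp[symmetric] image_quotient_map_mod_eq_iff[OF M] by blast

lemma finite_codim_iff:
  assumes M: "real_vector.subspace M"
  shows "finite_codim smul M \<longleftrightarrow> (\<exists>B. finite B \<and> (\<forall>y. \<exists>s\<in>module.span smul B. y - s \<in> M))"
  by (simp add: finite_codim_def image_quotient_map_mod_eq_iff[OF M])

section \<open>Triangular systems and normalised functionals\<close>

text \<open>Back substitution starts from the largest index. Subtracting \<open>d n\<close> times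
  \<open>y n\<close> changes only the data of smaller index, in total by at most half of
  \<open>norm (d n)\<close>. The constant \<open>2 * R\<close> is stable: the cost \<open>R\<close>
  of \<open>y n\<close> and \<open>2 * R\<close> times that half add up to it.\<close>

lemma triangular_system_solvable:
  fixes z :: "nat \<Rightarrow> 'b::banach \<Rightarrow>\<^sub>L 'k::{real_normed_field,banach}"
  assumes "banach_space_over smul" and z: "\<And>n. z n \<in> dual_space smul"
    and y: "\<And>n. norm (y n) \<le> R" "\<And>n. z n (y n) = 1"
      "\<And>j n. n < j \<Longrightarrow> z j (y n) = 0" "\<And>n. (\<Sum>j<n. norm (z j (y n))) \<le> 1 / 2"
    and "\<And>k. k \<ge> n \<Longrightarrow> d k = 0"
  shows "\<exists>v. norm v \<le> 2 * R * (\<Sum>k<n. norm (d k)) \<and> (\<forall>k. z k v = d k)"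
  using assms(7)
proof (induction n arbitrary: d)
  case 0
  then show ?case by (intro exI[of _ 0]) simp
next
  case (Suc n)
  interpret banach_space_over smul by fact
  have R: "R \<ge> 0" using y(1) norm_ge_zero order_trans by metis
  let ?a = "d n"
  let ?d = "\<lambda>k. d k - ?a * z k (y n)"
  have "?d k = 0" if "k \<ge> n" for k
  proof (cases "k = n")
    case False
    with that show ?thesis using y(3)[of n k] Suc.prems[of k] by simp
  qed (simp add: y(2))
  then obtain v where v: "norm v \<le> 2 * R * (\<Sum>k<n. norm (?d k))" "\<And>k. z k v = ?d k"
    using Suc.IH[of ?d] by blast
  have "(\<Sum>k<n. norm (?d k)) \<le> (\<Sum>k<n. norm (d k)) + norm ?a * (\<Sum>k<n. norm (z k (y n)))"
    unfolding sum_distrib_left sum.distrib[symmetric]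
    by (intro sum_mono) (metis norm_mult norm_triangle_ineq4)
  also have "\<dots> \<le> (\<Sum>k<n. norm (d k)) + norm ?a * (1 / 2)"
    using y(4)[of n] by (intro add_left_mono mult_left_mono) auto
  finally have "2 * R * (\<Sum>k<n. norm (?d k)) \<le> 2 * R * ((\<Sum>k<n. norm (d k)) + norm ?a * (1 / 2))"
    using R by (intro mult_left_mono) auto
  moreover have "norm (v + smul ?a (y n)) \<le> norm v + norm ?a * R"
    using norm_triangle_ineq[of v "smul ?a (y n)"] mult_left_mono[OF y(1)[of n], of "norm ?a"]
    by (simp add: norm_smul)
  ultimately have "norm (v + smul ?a (y n)) \<le> 2 * R * (\<Sum>k<Suc n. norm (d k))"
    using v(1) by (simp add: algebra_simps)
  moreover have "z k (v + smul ?a (y n)) = d k" for k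
    by (simp add: v(2) blinfun.add_right dual_space_smul[OF z])
  ultimately show ?case by blast
qed

context hahn_banach_space
begin

text \<open>Evaluations at the points of \<open>G\<close> are finitely many functionals on
  \<open>Z\<close>, so they are interpolated on a finite-dimensional span. An element of
  \<open>Z\<close> outside this span minus its interpolant is nonzero and vanishes on
  \<open>G\<close>.\<close>

lemma ex_norm_one_annihilating:
  fixes Z :: "('b \<Rightarrow>\<^sub>L 'k) set"
  assumes Z: "dual.subspace Z" "\<not> finite_dim dual_scale Z" and "finite G"
  obtains z where "z \<in> Z" "norm z = 1" "\<And>g. g \<in> G \<Longrightarrow> z g = 0"
proof -
  let ?\<Phi> = "(\<lambda>g f. blinfun_apply f g) ` G"
  have lin: "Vector_Spaces.linear dual_scale (*) (\<lambda>f. blinfun_apply f g)"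
    for g :: 'b
    by unfold_locales (auto intro!: blinfun_eqI simp: blinfun.add_left algebra_simps)
  have fin: "finite ?\<Phi>" using \<open>finite G\<close> by simp
  have "Vector_Spaces.linear dual_scale (*) \<phi>" if "\<phi> \<in> ?\<Phi>" for \<phi>
    using that lin by (elim imageE) simp
  from fin Z(1) this obtain B where B: "finite B" "B \<subseteq> Z" "\<And>z. z \<in> Z \<Longrightarrow> \<exists>s\<in>dual.span B. \<forall>\<phi>\<in>?\<Phi>. \<phi> s = \<phi> z"
    by (rule dual.finite_span_interpolates) (assumption, rule that)
  have sub: "dual.span B \<subseteq> Z" using B(2) Z(1) by (rule dual.span_minimal)
  moreover have "dual.span B \<noteq> Z" using Z(2) B(1) by (auto simp: finite_dim_def)
  ultimately obtain w where w: "w \<in> Z" "w \<notin> dual.span B" by blast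
  then obtain s where s: "s \<in> dual.span B" "\<And>g. g \<in> G \<Longrightarrow> s g = w g"
    using B(3)[OF w(1)] by auto
  let ?f = "w - s"
  have f: "?f \<in> Z" "?f \<noteq> 0" "\<And>g. g \<in> G \<Longrightarrow> ?f g = 0"
    using s w sub by (auto simp: blinfun.diff_left intro: dual.subspace_diff[OF Z(1)])
  show thesis
  proof
    show "dual_scale (of_real (inverse (norm ?f))) ?f \<in> Z"
      using Z(1) f(1) by (rule dual.subspace_scale)
    show "norm (dual_scale (of_real (inverse (norm ?f)) :: 'k) ?f) = 1"
      using f(2) by (simp add: dual.norm_smul del: of_real_inverse)
    show "dual_scale (of_real (inverse (norm ?f)) :: 'k) ?f g = 0" if "g \<in> G" for g
      using f(3)[OF that] by simp
  qed
qed

text \<open>A vector at which \<open>z\<close> exceeds half of its norm is rescaled. The resulting 2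
  is the radius of the ball for which approximants are prepared below.\<close>

lemma ex_unit_value:
  fixes z :: "'b \<Rightarrow>\<^sub>L 'k"
  assumes "z \<in> dual_space smul" "norm z = 1"
  obtains v where "norm v \<le> 2" "z v = 1"
proof -
  have "\<exists>v. norm (z v) > 1 / 2 * norm v"
  proof (rule ccontr)
    assume "\<not> ?thesis"
    then have "norm z \<le> 1 / 2" by (intro norm_blinfun_bound) (auto simp: not_less)
    with assms(2) show False by simp
  qed
  then obtain v where v: "norm (z v) > 1 / 2 * norm v" by blast
  then have pos: "norm (z v) > 0" using norm_ge_zero[of v] by linarith
  show thesis
  proof
    show "z (smul (inverse (z v)) v) = 1"
      using pos assms(1) by (simp add: dual_space_smul)
    show "norm (smul (inverse (z v)) v) \<le> 2"
      using v pos by (simp add: norm_smul norm_divide inverse_eq_divide divide_le_eq)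
  qed
qed

end


section \<open>Strictly cosingular operators\<close>

context hahn_banach_operator
begin

text \<open>At stage \<open>n\<close> the finite set \<open>F n\<close> is built from the earlier
  functionals, before \<open>z n\<close> is chosen; hence \<open>z n\<close> can vanish on the image
  of \<open>F n\<close> too. Subtracting from a vector with value 1 under \<open>z n\<close> its
  approximant from that image keeps this value and makes the values of the earlier functionals
  small.\<close>

lemma ex_biorthogonal_system:
  fixes Z :: "('b \<Rightarrow>\<^sub>L 'k) set" and D :: "nat \<Rightarrow> 'b" and \<epsilon> :: "nat \<Rightarrow> real"
  assumes Z: "Z \<subseteq> dual_space smul" "dual.subspace Z" "\<not> finite_dim dual_scale Z"
    and c: "c > 0" "\<And>z :: 'b \<Rightarrow>\<^sub>L 'k. z \<in> Z \<Longrightarrow> c * norm z \<le> norm (dual_map T z)"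
    and \<epsilon>: "\<And>n. \<epsilon> n > 0"
  obtains z :: "nat \<Rightarrow> 'b \<Rightarrow>\<^sub>L 'k" and F y R where
    "\<And>n. z n \<in> Z"
    "\<And>n u. u \<in> F n \<Longrightarrow> norm u \<le> 2 / c + 1"
    "\<And>n v. norm v \<le> 2 \<Longrightarrow> \<exists>u\<in>F n. \<forall>j<n. norm (z j (T u - v)) \<le> \<epsilon> n"
    "\<And>m n u. u \<in> F m \<Longrightarrow> m \<le> n \<Longrightarrow> z n (T u) = 0"
    "\<And>i n. i \<le> n \<Longrightarrow> z n (D i) = 0"
    "\<And>n. norm (y n) \<le> R" "\<And>n. z n (y n) = 1"
    "\<And>j n. n < j \<Longrightarrow> z j (y n) = 0" "\<And>j n. j < n \<Longrightarrow> norm (z j (y n)) \<le> \<epsilon> n"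
proof -
  define C where "C = 2 / c + 1"
  \<comment> \<open>This bounds \<open>v - T u\<close> for \<open>v\<close> in the ball of radius 2
    and an approximant \<open>u\<close> of norm at most \<open>C\<close>.\<close>
  define R where "R = 2 + norm T * C"
  \<comment> \<open>The triple consists of the functional, the set of approximants and the almost
    biorthogonal vector of stage \<open>n\<close>. Only values of \<open>f\<close> below
    \<open>n\<close> enter, as recursive choice along the natural numbers demands.\<close>
  define P where "P f n = (\<lambda>(z :: 'b \<Rightarrow>\<^sub>L 'k, F, y).
      z \<in> Z \<and> finite F \<and> (\<forall>u\<in>F. norm u \<le> C) \<and>
      (\<forall>v. norm v \<le> 2 \<longrightarrow> (\<exists>u\<in>F. \<forall>j<n. norm (blinfun_apply (fst (f j)) (T u - v)) \<le> \<epsilon> n)) \<and>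
      (\<forall>u\<in>F. z (T u) = 0) \<and> (\<forall>m<n. \<forall>u\<in>fst (snd (f m)). z (T u) = 0) \<and>
      (\<forall>i\<le>n. z (D i) = 0) \<and> norm y \<le> R \<and> z y = 1 \<and>
      (\<forall>j<n. z (snd (snd (f j))) = 0) \<and>
      (\<forall>j<n. norm (blinfun_apply (fst (f j)) y) \<le> \<epsilon> n))"
    for f :: "nat \<Rightarrow> ('b \<Rightarrow>\<^sub>L 'k) \<times> 'a set \<times> 'b" and n
  have "\<exists>f. \<forall>n. P f n (f n)"
  proof (rule dependent_wellorder_choice)
    fix r and f g :: "nat \<Rightarrow> ('b \<Rightarrow>\<^sub>L 'k) \<times> 'a set \<times> 'b" and n :: nat
    assume "\<And>j. j < n \<Longrightarrow> f j = g j"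
    then show "P f n r = P g n r" by (simp add: P_def)
  next
    fix n and f :: "nat \<Rightarrow> ('b \<Rightarrow>\<^sub>L 'k) \<times> 'a set \<times> 'b"
    assume IH: "\<And>j. j < n \<Longrightarrow> P f j (f j)"
    let ?B = "(\<lambda>j. fst (f j)) ` {..<n}"
    have B: "?B \<subseteq> Z" using IH by (force simp: P_def split: prod.splits)
    obtain F where F: "finite F" "\<And>u. u \<in> F \<Longrightarrow> norm u \<le> C"
      "\<And>v. norm v \<le> 2 \<Longrightarrow> \<exists>u\<in>F. \<forall>z\<in>?B. norm (blinfun_apply z (T u - v)) \<le> \<epsilon> n"
      using finite_approx_preimages[OF Z(1,2) c _ B \<epsilon>, of 2] unfolding C_def by auto
    \<comment> \<open>This finite set collects all points that \<open>z n\<close> has to kill: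
      images of approximants up to stage \<open>n\<close>, the first \<open>n + 1\<close> dense
      points and the earlier vectors.\<close>
    let ?G = "blinfun_apply T ` (F \<union> (\<Union>m<n. fst (snd (f m)))) \<union> D ` {..n} \<union> (\<lambda>j. snd (snd (f j))) ` {..<n}"
    have "finite (fst (snd (f m)))" if "m < n" for m
      using IH[OF that] by (auto simp: P_def split: prod.splits)
    then have "finite ?G" using F(1) by simp
    from ex_norm_one_annihilating[OF Z(2,3) this]
    obtain z where z: "z \<in> Z" "norm z = 1" "\<And>g. g \<in> ?G \<Longrightarrow> z g = 0" by blast
    obtain v where v: "norm v \<le> 2" "z v = 1"
      using ex_unit_value[of z] z(1,2) Z(1) by blast
    obtain u where u: "u \<in> F" "\<And>j. j < n \<Longrightarrow> norm (blinfun_apply (fst (f j)) (T u - v)) \<le> \<epsilon> n"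
      using F(3)[OF v(1)] by auto
    have "norm (T u) \<le> norm T * C"
      using norm_blinfun[of T u] mult_left_mono[OF F(2)[OF u(1)], of "norm T"] by simp
    then have "norm (v - T u) \<le> R"
      using norm_triangle_ineq4[of v "T u"] v(1) by (simp add: R_def)
    moreover have "z (v - T u) = 1"
      using v(2) z(3)[of "T u"] u(1) by (simp add: blinfun.diff_right)
    moreover have "norm (blinfun_apply (fst (f j)) (v - T u)) \<le> \<epsilon> n" if "j < n" for j
      using u(2)[OF that] by (simp add: blinfun.diff_right norm_minus_commute)
    moreover have "\<exists>u\<in>F. \<forall>j<n. norm (blinfun_apply (fst (f j)) (T u - w)) \<le> \<epsilon> n"
      if "norm w \<le> 2" for w
      using F(3)[OF that] by blast
    moreover have "z (T u) = 0" if "u \<in> F" for u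
      using that by (intro z(3)) blast
    moreover have "z (T u) = 0" if "m < n" "u \<in> fst (snd (f m))" for m u
      using that by (intro z(3)) blast
    moreover have "z (D i) = 0" if "i \<le> n" for i
      using that by (intro z(3)) blast
    moreover have "z (snd (snd (f j))) = 0" if "j < n" for j
      using that by (intro z(3)) blast
    ultimately have "P f n (z, F, v - T u)"
      using z(1) F(1,2) by (simp add: P_def)
    then show "\<exists>r. P f n r" ..
  qed
  then obtain f where f: "\<And>n. P f n (f n)" by blast
  show thesis
  proof (rule that[of "\<lambda>n. fst (f n)" "\<lambda>n. fst (snd (f n))" "\<lambda>n. snd (snd (f n))" R])
    fix m n u
    assume "u \<in> fst (snd (f m))" "m \<le> n"
    then show "blinfun_apply (fst (f n)) (T u) = 0"
      using f[of n] by (auto simp: P_def split_def le_less)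
  qed (use f in \<open>auto simp: P_def split_def C_def\<close>)
qed

text \<open>\<open>M\<close> is the common kernel of the functionals \<open>z n\<close>. Solvability
  modulo \<open>M\<close> is reduced to solving up to an error of \<open>1 / 2\<close> on the unit
  ball with uniformly bounded \<open>x\<close>.\<close>

lemma ex_subspace_of_bounded_below:
  fixes Z :: "('b \<Rightarrow>\<^sub>L 'k) set"
  assumes sep: "separable_space (euclidean :: 'b topology)"
    and Z: "Z \<subseteq> dual_space smul" "dual.subspace Z" "\<not> finite_dim dual_scale Z"
    and c: "c > 0" "\<And>z :: 'b \<Rightarrow>\<^sub>L 'k. z \<in> Z \<Longrightarrow> c * norm z \<le> norm (dual_map T z)"
  obtains M where "subspace M" "closed M" "\<not> finite_codim smul M" "\<And>y. \<exists>x. y - T x \<in> M"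
proof -
  obtain S :: "'b set" where S: "countable S" "closure S = UNIV"
    using sep by (auto simp: separable_space_def)
  then have "S \<noteq> {}" by auto
  define D where "D = from_nat_into S"
  have D: "range D = S" using S(1) \<open>S \<noteq> {}\<close> by (simp add: D_def)
  \<comment> \<open>With this choice \<open>n\<close> errors of size \<open>\<epsilon> n\<close> add
    up to at most \<open>1 / 2\<close>, as the triangular system requires, and their total tends to
    0.\<close>
  define \<epsilon> :: "nat \<Rightarrow> real" where "\<epsilon> n = inverse (real (Suc n)) / (2 * real (Suc n))" for n
  have \<epsilon>: "\<epsilon> n > 0" for n by (simp add: \<epsilon>_def)
  have n\<epsilon>: "real n * \<epsilon> n \<le> inverse (real (Suc n)) * (1 / 2)" for n
  proof -
    have "real n * \<epsilon> n = inverse (real (Suc n)) * (real n / (2 * real (Suc n)))"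
      by (simp add: \<epsilon>_def)
    also have "\<dots> \<le> inverse (real (Suc n)) * (1 / 2)"
      by (intro mult_left_mono) (simp_all add: divide_le_eq)
    finally show ?thesis .
  qed
  obtain z :: "nat \<Rightarrow> 'b \<Rightarrow>\<^sub>L 'k" and F y R where z: "\<And>n. z n \<in> Z"
    and F: "\<And>n u. u \<in> F n \<Longrightarrow> norm u \<le> 2 / c + 1"
      "\<And>n v. norm v \<le> 2 \<Longrightarrow> \<exists>u\<in>F n. \<forall>j<n. norm (z j (T u - v)) \<le> \<epsilon> n"
      "\<And>m n u. u \<in> F m \<Longrightarrow> m \<le> n \<Longrightarrow> z n (T u) = 0"
    and zD: "\<And>i n. i \<le> n \<Longrightarrow> z n (D i) = 0"
    and y: "\<And>n. norm (y n) \<le> R" "\<And>n. z n (y n) = 1" "\<And>j n. n < j \<Longrightarrow> z j (y n) = 0"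
    and small: "\<And>j n. j < n \<Longrightarrow> norm (z j (y n)) \<le> \<epsilon> n"
    by (rule ex_biorthogonal_system[where D = D and \<epsilon> = \<epsilon>, OF Z c \<epsilon>]) (assumption, rule that)
  have half: "real n * \<epsilon> n \<le> 1 / 2" for n
  proof -
    have "inverse (real (Suc n)) * (1 / 2) \<le> 1 * (1 / 2)"
      by (intro mult_right_mono) (simp_all add: inverse_le_1_iff)
    with n\<epsilon>[of n] show ?thesis by linarith
  qed
  have "(\<Sum>j<n. norm (z j (y n))) \<le> 1 / 2" for n
    using sum_bounded_above[of "{..<n}" "\<lambda>j. norm (z j (y n))" "\<epsilon> n"] small half[of n] by simp
  note solve = triangular_system_solvable[OF banach_space_over_axioms _ y this]
  have dual: "z n \<in> dual_space smul" for n using z Z(1) by blast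
  define M where "M = {v. \<forall>n. z n v = 0}"
  have M: "subspace M"
    using dual by (auto simp: subspace_def M_def blinfun.add_right dual_space_smul)
  have rM: "real_vector.subspace M" using M by (rule subspace_imp_real_subspace)
  have "M = (\<Inter>n. (\<lambda>v. z n v) -` {0})" by (auto simp: M_def)
  then have clM: "closed M"
    by (auto intro!: closed_INT closed_vimage continuous_intros)
  have R: "R \<ge> 0" using y(1) norm_ge_zero order_trans by metis
  have close: "\<exists>x. norm x \<le> 2 / c + 1 \<and> (\<exists>m\<in>M. norm (v - T x - m) \<le> 1 / 2)"
    if v: "norm v \<le> 1" for v
  proof -
    obtain i where i: "dist (D i) v < 1 / 4"
    proof -
      have "v \<in> closure S" using S(2) by simp
      then obtain s where "s \<in> S" "dist s v < 1 / 4"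
        unfolding closure_approachable by (meson zero_less_divide_1_iff zero_less_numeral)
      with D that show ?thesis by (metis rangeE)
    qed
    have Di: "norm (D i) \<le> 2"
      using i v norm_triangle_ineq2[of "D i" v] by (simp add: dist_norm)
    \<comment> \<open>Solving the triangular system multiplies the total error by
      \<open>2 * R\<close>; \<open>N\<close> keeps the result below \<open>1 / 4\<close>. The
      denominator contains \<open>R + 1\<close> to stay positive when \<open>R = 0\<close>.\<close>
    obtain N where N: "inverse (real (Suc N)) < 1 / (4 * (R + 1))"
      using reals_Archimedean[of "1 / (4 * (R + 1))"] R by auto
    \<comment> \<open>From \<open>i\<close> on the functionals vanish at \<open>D i\<close>, and
      from stage \<open>n\<close> on they vanish on the image of \<open>F n\<close>, so the system
      below has only \<open>n\<close> nonzero data.\<close>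
    define n where "n = max i N"
    obtain u where u: "u \<in> F n" "\<And>j. j < n \<Longrightarrow> norm (z j (T u - D i)) \<le> \<epsilon> n"
      using F(2)[OF Di] by blast
    have "z k (T u - D i) = 0" if "k \<ge> n" for k
      using F(3)[OF u(1) that] zD[of i k] that by (simp add: n_def blinfun.diff_right)
    then obtain w where w: "norm w \<le> 2 * R * (\<Sum>k<n. norm (z k (T u - D i)))"
      "\<And>k. z k w = z k (T u - D i)"
      using solve[of n "\<lambda>k. z k (T u - D i)"] dual by blast
    have "(\<Sum>k<n. norm (z k (T u - D i))) \<le> real n * \<epsilon> n"
      using sum_bounded_above[of "{..<n}" "\<lambda>k. norm (z k (T u - D i))" "\<epsilon> n"] u(2) by simp
    also have "\<dots> \<le> inverse (real (Suc n)) * (1 / 2)" by (rule n\<epsilon>)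
    also have "\<dots> \<le> inverse (real (Suc N)) * (1 / 2)"
      by (intro mult_right_mono) (auto simp: n_def)
    also have "\<dots> \<le> 1 / (4 * (R + 1)) * (1 / 2)"
      using N by (intro mult_right_mono) auto
    finally have "2 * R * (\<Sum>k<n. norm (z k (T u - D i))) \<le> 2 * R * (1 / (4 * (R + 1)) * (1 / 2))"
      using R by (intro mult_left_mono) auto
    also have "\<dots> \<le> 1 / 4" using R by (simp add: field_simps)
    finally have nw: "norm w \<le> 1 / 4" using w(1) by simp
    \<comment> \<open>\<open>w\<close> has the same values as \<open>T u - D i\<close> under every
      \<open>z k\<close>, hence repairs the approximant modulo \<open>M\<close>.\<close>
    have "D i - T u + w \<in> M"
      using w(2) by (simp add: M_def blinfun.add_right blinfun.diff_right)
    moreover have "norm (v - T u - (D i - T u + w)) \<le> 1 / 2"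
    proof -
      have "v - T u - (D i - T u + w) = (v - D i) - w" by simp
      then have "norm (v - T u - (D i - T u + w)) \<le> norm (v - D i) + norm w"
        by (simp only: norm_triangle_ineq4)
      moreover have "norm (v - D i) < 1 / 4"
        using i by (simp add: dist_norm norm_minus_commute)
      ultimately show ?thesis using nw by linarith
    qed
    ultimately show ?thesis using F(1)[OF u(1)] by blast
  qed
  have "\<not> finite_codim smul M"
  proof
    assume "finite_codim smul M"
    then obtain B where B: "finite B" "\<And>v. \<exists>s\<in>span B. v - s \<in> M"
      using finite_codim_iff[OF rM] by blast
    \<comment> \<open>The triangular system yields vectors exactly biorthogonal to the sequence.
      Replacing them modulo \<open>M\<close> by elements of \<open>span B\<close> keeps all values
      \<open>z j\<close>, so a finite set would span infinitely many independent vectors.\<close>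
    have "\<exists>s\<in>span B. \<forall>j. z j s = (if j = k then 1 else 0)" for k
    proof -
      obtain v where v: "\<And>j. z j v = (if j = k then 1 else 0)"
        using solve[of "Suc k" "\<lambda>j. if j = k then 1 else 0"] dual by auto
      obtain s where "s \<in> span B" "v - s \<in> M" using B(2) by blast
      with v show ?thesis by (force simp: M_def blinfun.diff_right)
    qed
    then obtain s where s: "\<And>k. s k \<in> span B" "\<And>j k. z j (s k) = (if j = k then 1 else 0)"
      by metis
    have "inj s" by (rule injI) (metis s(2) zero_neq_one)
    have "independent (range s)"
      unfolding dependent_explicit
    proof (intro notI, elim exE conjE bexE)
      fix t a w
      assume t: "finite t" "t \<subseteq> range s" "(\<Sum>v\<in>t. smul (a v) v) = 0" "w \<in> t" "a w \<noteq> 0"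
      then obtain k where k: "w = s k" by blast
      have "0 = z k (\<Sum>v\<in>t. smul (a v) v)" using t(3) by simp
      also have "\<dots> = (\<Sum>v\<in>t. a v * z k v)"
        by (simp add: blinfun.sum_right dual_space_smul[OF dual])
      also have "\<dots> = (\<Sum>v\<in>t. if v = w then a v else 0)"
      proof (rule sum.cong)
        fix v assume "v \<in> t"
        then obtain l where "v = s l" using t(2) by blast
        with k \<open>inj s\<close> show "a v * z k v = (if v = w then a v else 0)"
          by (auto simp: s(2) inj_eq)
      qed simp
      also have "\<dots> = a w" using t(1,4) by simp
      finally show False using t(5) by simp
    qed
    with B(1) s(1) have "finite (range s)"
      using independent_span_bound[of B "range s"] by blast
    with \<open>inj s\<close> show False using finite_imageD by blast
  qed
  with M clM solvable_mod_if_approx[OF rM clM close] that show thesis by blast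
qed

section \<open>Annihilators of closed subspaces and the equivalence\<close>

text \<open>By Baire, the closure of the image of some ball plus \<open>M\<close> contains a ball.
  On that closure a functional vanishing on \<open>M\<close> is controlled by its image under the
  adjoint.\<close>

lemma annihilator_bounded_below:
  assumes M: "subspace M" and surj: "\<And>y. \<exists>x. y - T x \<in> M"
  obtains c where "c > 0"
    "\<And>f :: 'b \<Rightarrow>\<^sub>L 'k. (\<And>m. m \<in> M \<Longrightarrow> blinfun_apply f m = 0) \<Longrightarrow> c * norm f \<le> norm (dual_map T f)"
proof -
  define A where "A n = closure {T x + m |x m. norm x \<le> real n \<and> m \<in> M}" for n
  have "(\<Union>n. A n) = UNIV"
  proof -
    have "\<exists>n. y \<in> A n" for y
    proof -
      obtain x where x: "y - T x \<in> M" using surj by blast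
      obtain n where n: "norm x \<le> real n" using real_arch_simple by blast
      have "y = T x + (y - T x)" by simp
      with x n have "y \<in> {T x + m |x m. norm x \<le> real n \<and> m \<in> M}" by blast
      then have "y \<in> A n" unfolding A_def by (rule subsetD[OF closure_subset])
      then show ?thesis ..
    qed
    then show ?thesis by blast
  qed
  moreover have "interior (\<Union>n. A n) = {}" if "\<And>n. interior (A n) = {}"
  proof -
    have "euclidean interior_of \<Union>(range A) = {}"
      by (rule Baire_category_alt) (use that completely_metrizable_space_euclidean in \<open>auto simp: A_def\<close>)
    then show ?thesis by simp
  qed
  ultimately obtain n where "interior (A n) \<noteq> {}" by (metis interior_UNIV UNIV_not_empty)
  then obtain y0 e where e: "e > 0" "ball y0 e \<subseteq> A n"
    by (auto simp: mem_interior)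
  show thesis
  proof
    \<comment> \<open>One factor 2 comes from taking the difference of two points of the ball, the
      other from moving only by \<open>e / 2\<close>; the summand 1 covers
      \<open>n = 0\<close>.\<close>
    show "e / (4 * real n + 1) > 0" using e(1) by simp
    fix f :: "'b \<Rightarrow>\<^sub>L 'k"
    assume f: "\<And>m. m \<in> M \<Longrightarrow> blinfun_apply f m = 0"
    let ?N = "norm (dual_map T f)"
    have fA: "norm (f v) \<le> real n * ?N" if "v \<in> A n" for v
    proof -
      have "norm (f (T x + m)) \<le> real n * ?N" if "norm x \<le> real n" "m \<in> M" for x m
        using norm_blinfun[of "dual_map T f" x] mult_left_mono[OF that(1), of ?N] f[OF that(2)]
        by (simp add: blinfun.add_right mult.commute)
      then have "{T x + m |x m. norm x \<le> real n \<and> m \<in> M} \<subseteq> {v. norm (f v) \<le> real n * ?N}"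
        by blast
      moreover have "closed {v. norm (f v) \<le> real n * ?N}"
        by (intro closed_Collect_le continuous_intros)
      ultimately have "A n \<subseteq> {v. norm (f v) \<le> real n * ?N}"
        unfolding A_def by (rule closure_minimal)
      with that show ?thesis by blast
    qed
    have "norm f \<le> 4 * real n * ?N / e"
    proof (rule norm_blinfun_bound)
      fix v
      show "norm (f v) \<le> 4 * real n * ?N / e * norm v"
      proof (cases "v = 0")
        case False
        let ?t = "e / (2 * norm v)"
        have t: "?t > 0" using e(1) False by simp
        have "dist y0 (y0 + ?t *\<^sub>R v) < e" using e(1) False by (simp add: dist_norm)
        then have "norm (f (y0 + ?t *\<^sub>R v)) \<le> real n * ?N" "norm (f y0) \<le> real n * ?N"
          using e by (auto intro!: fA)
        then have "norm (?t *\<^sub>R f v) \<le> 2 * real n * ?N"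
          using norm_triangle_ineq4[of "f (y0 + ?t *\<^sub>R v)" "f y0"]
          by (simp add: blinfun.add_right blinfun.scaleR_right)
        then have "?t * norm (f v) \<le> 2 * real n * ?N" using e(1) by simp
        then show ?thesis using e(1) False by (simp add: field_simps)
      qed simp
    qed (use e(1) in simp)
    then have "e * norm f \<le> 4 * real n * ?N" using e(1) by (simp add: field_simps)
    also have "\<dots> \<le> (4 * real n + 1) * ?N" by (intro mult_right_mono) auto
    finally show "e / (4 * real n + 1) * norm f \<le> ?N"
      by (simp add: divide_le_eq mult.commute)
  qed
qed

text \<open>If finitely many functionals span the annihilator, every \<open>y\<close> agrees under
  them with an element of a fixed finite span. The difference is killed by the whole annihilator,
  hence lies in \<open>M\<close> by separation, and \<open>M\<close> has finite codimension.\<close>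

lemma annihilator_not_finite_dim:
  fixes M :: "'b set"
  assumes M: "subspace M" "closed M" "\<not> finite_codim smul M"
  shows "\<not> finite_dim dual_scale {f :: 'b \<Rightarrow>\<^sub>L 'k. f \<in> dual_space smul \<and> (\<forall>m\<in>M. blinfun_apply f m = 0)}"
proof
  let ?Z = "{f :: 'b \<Rightarrow>\<^sub>L 'k. f \<in> dual_space smul \<and> (\<forall>m\<in>M. blinfun_apply f m = 0)}"
  assume "finite_dim dual_scale ?Z"
  then obtain B where B: "finite B" "dual.span B = ?Z" by (auto simp: finite_dim_def)
  have fin: "finite (blinfun_apply ` B)" using B(1) by simp
  have "Vector_Spaces.linear smul (*) \<phi>" if "\<phi> \<in> blinfun_apply ` B" for \<phi>
    using that B(2) dual.span_superset[of B] by (auto simp: dual_space_def)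
  from fin subspace_UNIV this obtain E where E: "finite E" "E \<subseteq> UNIV"
      "\<And>y. y \<in> UNIV \<Longrightarrow> \<exists>s\<in>span E. \<forall>\<phi>\<in>blinfun_apply ` B. \<phi> s = \<phi> y"
    by (rule finite_span_interpolates) (assumption, rule that)
  have "\<exists>s\<in>span E. y - s \<in> M" for y
  proof -
    obtain s where s: "s \<in> span E" "\<And>f. f \<in> B \<Longrightarrow> f s = f y" using E(3)[of y] by blast
    have "dual.subspace {f. blinfun_apply f (y - s) = (0 :: 'k)}"
      by (auto simp: dual.subspace_def blinfun.add_left)
    moreover have "B \<subseteq> {f. blinfun_apply f (y - s) = 0}"
      using s(2) by (auto simp: blinfun.diff_right)
    ultimately have "dual.span B \<subseteq> {f. blinfun_apply f (y - s) = 0}"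
      by (intro dual.span_minimal)
    then have "f (y - s) = 0" if "f \<in> dual_space smul" "\<And>m. m \<in> M \<Longrightarrow> f m = 0" for f :: "'b \<Rightarrow>\<^sub>L 'k"
      using that unfolding B(2) by blast
    then have "y - s \<in> M"
      using closed_subspace_separation[OF M(1,2), of "y - s"] by blast
    with s(1) show ?thesis by blast
  qed
  then have "finite_codim smul M"
    using E(1) finite_codim_iff[OF subspace_imp_real_subspace[OF M(1)]] by blast
  with M(3) show False ..
qed

theorem strictly_cosingular_iff_adjoint_strictly_singular:
  assumes "separable_space (euclidean :: 'b topology)"
  shows "strictly_cosingular smul T \<longleftrightarrow>
    strictly_singular_on dual_scale (dual_space smul) (dual_map T)"
proof
  assume cosing: "strictly_cosingular smul T"
  show "strictly_singular_on dual_scale (dual_space smul) (dual_map T)"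
    unfolding strictly_singular_on_def
  proof (intro allI impI notI, elim conjE)
    fix Z :: "('b \<Rightarrow>\<^sub>L 'k) set"
    assume Z: "Z \<subseteq> dual_space smul" "dual.subspace Z" "\<not> finite_dim dual_scale Z"
      and "bounded_below_on (dual_map T) Z"
    then obtain c where "c > 0" "\<And>z. z \<in> Z \<Longrightarrow> c * norm z \<le> norm (dual_map T z)"
      by (auto simp: bounded_below_on_def)
    from ex_subspace_of_bounded_below[OF assms Z this] obtain M
      where M: "subspace M" "closed M" "\<not> finite_codim smul M" "\<And>y. \<exists>x. y - T x \<in> M"
      by blast
    with cosing show False
      unfolding strictly_cosingular_def
      using range_quotient_map_mod_comp_eq_iff[OF subspace_imp_real_subspace[OF M(1)], of T] by blast
  qed
next
  assume sing: "strictly_singular_on dual_scale (dual_space smul) (dual_map T)"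
  show "strictly_cosingular smul T"
    unfolding strictly_cosingular_def
  proof (intro allI impI notI, elim conjE)
    fix M
    assume M: "subspace M" "closed M" "\<not> finite_codim smul M"
      and "range (quotient_map_mod M \<circ> T) = quotient_mod M"
    then have "\<And>y. \<exists>x. y - T x \<in> M"
      using range_quotient_map_mod_comp_eq_iff[OF subspace_imp_real_subspace[OF M(1)], of T] by blast
    from annihilator_bounded_below[OF M(1) this] obtain c where c: "c > 0"
      "\<And>f :: 'b \<Rightarrow>\<^sub>L 'k. (\<And>m. m \<in> M \<Longrightarrow> blinfun_apply f m = 0) \<Longrightarrow> c * norm f \<le> norm (dual_map T f)"
      by blast
    let ?Z = "{f :: 'b \<Rightarrow>\<^sub>L 'k. f \<in> dual_space smul \<and> (\<forall>m\<in>M. blinfun_apply f m = 0)}"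
    have "bounded_below_on (dual_map T) ?Z"
      unfolding bounded_below_on_def using c by blast
    moreover have "dual.subspace ?Z"
      using subspace_dual_space by (auto simp: dual.subspace_def blinfun.add_left)
    moreover have "closed ?Z"
    proof -
      \<comment> \<open>Linearity over \<open>'k\<close> and vanishing on \<open>M\<close> are both
        equations between continuous functions of \<open>f\<close>.\<close>
      have "?Z = (\<Inter>(c, v). {f. blinfun_apply f (smul c v) = c * f v}) \<inter> (\<Inter>m\<in>M. {f. blinfun_apply f m = 0})"
        by (auto intro: dual_spaceI simp: dual_space_smul)
      also have "closed \<dots>"
        by (intro closed_Int closed_INT ballI) (auto intro!: closed_Collect_eq continuous_intros)
      finally show ?thesis .
    qed
    moreover have "?Z \<subseteq> dual_space smul" by blast
    ultimately show False
      using sing[unfolded strictly_singular_on_def, THEN spec, of ?Z]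
        annihilator_not_finite_dim[OF M] by simp
  qed
qed

end

section \<open>The equivalence for real and for complex scalars\<close>

theorem theorem7p2:
  fixes T :: "'a::banach \<Rightarrow>\<^sub>L 'b::banach"
  assumes "separable_space (euclidean :: 'b topology)"
  shows "(strictly_cosingular (scaleR :: real \<Rightarrow> 'b \<Rightarrow> 'b) (blinfun_apply T) \<longleftrightarrow>
            strictly_singular_on dual_scale (dual_space (scaleR :: real \<Rightarrow> 'b \<Rightarrow> 'b)) (dual_map T))
       \<and> (\<forall>(sX :: complex \<Rightarrow> 'a \<Rightarrow> 'a) (sY :: complex \<Rightarrow> 'b \<Rightarrow> 'b).
            banach_space_over sX \<and> banach_space_over sY \<and>
            Vector_Spaces.linear sX sY (blinfun_apply T) \<longrightarrow>
            (strictly_cosingular sY (blinfun_apply T) \<longleftrightarrow>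
             strictly_singular_on dual_scale (dual_space sY) (dual_map T)))"
proof (intro conjI allI impI, goal_cases)
  case 1
  have "Vector_Spaces.linear scaleR scaleR (blinfun_apply T)"
    using bounded_linear.linear[OF blinfun.bounded_linear_right] by (simp add: linear_def)
  then have "hahn_banach_operator (scaleR :: real \<Rightarrow> 'b \<Rightarrow> 'b) scaleR T"
    by (intro hahn_banach_operator.intro hahn_banach_operator_axioms.intro
        hahn_banach_space_real banach_space_over_scaleR)
  then show ?case
    using assms by (rule hahn_banach_operator.strictly_cosingular_iff_adjoint_strictly_singular)
next
  case (2 sX sY)
  then have "hahn_banach_operator sY sX T"
    by (intro hahn_banach_operator.intro hahn_banach_operator_axioms.intro
        hahn_banach_space_complex) auto
  then show ?case
    using assms by (rule hahn_banach_operator.strictly_cosingular_iff_adjoint_strictly_singular)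
qed

end
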